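(* Let $\Pi$ be a deterministic, memoryless $\{\textsc{Bland},\textsc{Dantzig},\textsc{LargestIncrease}\}$-ranking-based pivot rule. Then there exists a family of weak unichain Markov decision processes, with $N$ denoting the number of non-zero transition probabilities, such that \textsc{PolicyIteration} with pivot rule $\Pi$ takes $\Omega(2^{\sqrt N})$ iterations.
   Context: A Markov decision process has a finite state set $S$, a finite action set $A$, for each action $a$ a reward $\mathrm{rew}(a)\in\mathbb{R}$ and a probability distribution $(P_{a,s'})_{s'\in S}$, and for each state $s$ a non-empty set $A_s\subseteq A$ of available actions. A sink is a state $\top$ reachable from all states with $A_\top$ a single action of reward 0 leading to $\top$ with probability 1. A policy $\sigma$ picks $\sigma(s)\in A_s$ for each $s$; its values satisfy $\mathrm{val}_\sigma(s)=\mathrm{rew}(\sigma(s))+\sum_{s'}P_{\sigma(s),s'}\mathrm{val}_\sigma(s')$ with $\mathrm{val}_\sigma(\top)=0$. A policy is weak unichain if from every start state $\top$ is reached with probability one; the process is weak unichain if it has an optimal (value-maximizing for all states) policy that is weak unichain. The reduced cost of $a\in A_s$ is $\mathrm{rc}_\sigma(a)=\mathrm{rew}(a)+\sum_{s'}P_{a,s'}\mathrm{val}_\sigma(s')-\mathrm{val}_\sigma(s)$; $a$ is an improving switch if $\mathrm{rc}_\sigma(a)>0$; applying it gives $\sigma^a$ with $\sigma^a(s)=a$, otherwise equal to $\sigma$. \textsc{PolicyIteration} starts from a weak unichain policy and in each iteration applies one improving switch chosen by the pivot rule until none exists. Neighbor rankings (total preorders on the improving switches of $\sigma$, $a\preceq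 b$ meaning $b$ is at least as preferred): \textsc{Bland}: actions carry a fixed global indexing, smaller index preferred; \textsc{Dantzig}: $a\preceq b$ iff $\mathrm{rc}_\sigma(a)\le\mathrm{rc}_\sigma(b)$; \textsc{LargestIncrease}: $a\preceq b$ iff $\sum_s\mathrm{val}_{\sigma^a}(s)\le\sum_s\mathrm{val}_{\sigma^b}(s)$. A deterministic memoryless pivot rule selects one improving switch for each non-optimal weak unichain policy (no ties). It is $\{\textsc{Bland},\textsc{Dantzig},\textsc{LargestIncrease}\}$-ranking-based if, for any two processes (of any sizes) with non-optimal policies $\sigma,\sigma'$ and any bijection $\varphi$ between their sets of improving switches preserving each of the three preorders, if the rule selects $a$ at $\sigma$ then it selects $\varphi(a)$ at $\sigma'$. *)

theory Defs
  imports Complex_Main "HOL-Library.Extended_Real" "HOL-Library.Liminf_Limsup"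
begin

text \<open>Markov decision processes. States and actions are natural numbers, so that a single
  pivot-rule function can be applied to processes of arbitrary sizes. The natural-number label
  of an action serves as its fixed global (Bland) index.\<close>

record mdp =
  St :: "nat set"                 (* finite state set S *)
  Act :: "nat set"                (* finite action set A *)
  rew :: "nat \<Rightarrow> real"          (* reward of an action *)
  prob :: "nat \<Rightarrow> nat \<Rightarrow> real"  (* prob a s' = P_{a,s'} *)
  Av :: "nat \<Rightarrow> nat set"         (* available actions A_s *)
  sink :: nat                     (* the sink state *)

text \<open>One-step graph of the process (some available action leads there with positive probability).\<close>
definition edges :: "mdp \<Rightarrow> (nat \<times> nat) set" where
  "edges M = {(s, t). s \<in> St M \<and> (\<exists>a \<in> Av M s. prob M a t > 0)}"

definition is_mdp :: "mdp \<Rightarrow> bool" where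
  "is_mdp M \<longleftrightarrow>
     finite (St M) \<and> finite (Act M) \<and>
     (\<forall>s \<in> St M. Av M s \<noteq> {}) \<and>
     Act M = (\<Union>s \<in> St M. Av M s) \<and>
     (\<forall>s \<in> St M. \<forall>t \<in> St M. s \<noteq> t \<longrightarrow> Av M s \<inter> Av M t = {}) \<and>
     (\<forall>a \<in> Act M. (\<forall>t. prob M a t \<ge> 0) \<and> (\<forall>t. t \<notin> St M \<longrightarrow> prob M a t = 0)
                    \<and> (\<Sum>t \<in> St M. prob M a t) = 1) \<and>
     sink M \<in> St M \<and>
     (\<exists>a0. Av M (sink M) = {a0} \<and> rew M a0 = 0 \<and> prob M a0 (sink M) = 1) \<and>
     (\<forall>s \<in> St M. (s, sink M) \<in> (edges M)\<^sup>*)"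

definition policy :: "mdp \<Rightarrow> (nat \<Rightarrow> nat) \<Rightarrow> bool" where
  "policy M \<sigma> \<longleftrightarrow> (\<forall>s \<in> St M. \<sigma> s \<in> Av M s)"

text \<open>n-step transition probabilities of the Markov chain induced by a policy.\<close>
primrec dist :: "mdp \<Rightarrow> (nat \<Rightarrow> nat) \<Rightarrow> nat \<Rightarrow> nat \<Rightarrow> nat \<Rightarrow> real" where
  "dist M \<sigma> 0 s t = (if s = t then 1 else 0)"
| "dist M \<sigma> (Suc n) s t = (\<Sum>u \<in> St M. dist M \<sigma> n s u * prob M (\<sigma> u) t)"

text \<open>Weak unichain policy: from every start state the (absorbing) sink is reached with
  probability one, i.e. the probability of being in the sink after n steps tends to 1.\<close>
definition weak_unichain_policy :: "mdp \<Rightarrow> (nat \<Rightarrow> nat) \<Rightarrow> bool" where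
  "weak_unichain_policy M \<sigma> \<longleftrightarrow> policy M \<sigma> \<and>
     (\<forall>s \<in> St M. (\<lambda>n. dist M \<sigma> n s (sink M)) \<longlonglongrightarrow> 1)"

text \<open>Values of a policy (the unique solution of the value equations for weak unichain policies).\<close>
definition val :: "mdp \<Rightarrow> (nat \<Rightarrow> nat) \<Rightarrow> nat \<Rightarrow> real" where
  "val M \<sigma> = (THE v. (\<forall>s. s \<notin> St M \<longrightarrow> v s = 0) \<and> v (sink M) = 0 \<and>
       (\<forall>s \<in> St M. v s = rew M (\<sigma> s) + (\<Sum>t \<in> St M. prob M (\<sigma> s) t * v t)))"

text \<open>Expected total reward over the first n steps (used for optimality against arbitrary policies).\<close>
definition fin_reward :: "mdp \<Rightarrow> (nat \<Rightarrow> nat) \<Rightarrow> nat \<Rightarrow> nat \<Rightarrow> real" where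
  "fin_reward M \<sigma> n s = (\<Sum>k < n. \<Sum>u \<in> St M. dist M \<sigma> k s u * rew M (\<sigma> u))"

definition optimal_policy :: "mdp \<Rightarrow> (nat \<Rightarrow> nat) \<Rightarrow> bool" where
  "optimal_policy M \<sigma> \<longleftrightarrow> weak_unichain_policy M \<sigma> \<and>
     (\<forall>\<tau>. policy M \<tau> \<longrightarrow>
        (\<forall>s \<in> St M. limsup (\<lambda>n. ereal (fin_reward M \<tau> n s)) \<le> ereal (val M \<sigma> s)))"

definition weak_unichain_mdp :: "mdp \<Rightarrow> bool" where
  "weak_unichain_mdp M \<longleftrightarrow> is_mdp M \<and> (\<exists>\<sigma>. optimal_policy M \<sigma>)"

text \<open>The state to which an action belongs.\<close>
definition st_of :: "mdp \<Rightarrow> nat \<Rightarrow> nat" where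
  "st_of M a = (THE s. s \<in> St M \<and> a \<in> Av M s)"

definition rc :: "mdp \<Rightarrow> (nat \<Rightarrow> nat) \<Rightarrow> nat \<Rightarrow> real" where
  "rc M \<sigma> a = rew M a + (\<Sum>t \<in> St M. prob M a t * val M \<sigma> t) - val M \<sigma> (st_of M a)"

definition improving :: "mdp \<Rightarrow> (nat \<Rightarrow> nat) \<Rightarrow> nat set" where
  "improving M \<sigma> = {a \<in> Act M. rc M \<sigma> a > 0}"

definition switch :: "mdp \<Rightarrow> (nat \<Rightarrow> nat) \<Rightarrow> nat \<Rightarrow> (nat \<Rightarrow> nat)" where
  "switch M \<sigma> a = \<sigma>(st_of M a := a)"

text \<open>Neighbor rankings: a \<preceq> b means b is at least as preferred as a.\<close>
definition bland_le :: "mdp \<Rightarrow> (nat \<Rightarrow> nat) \<Rightarrow> nat \<Rightarrow> nat \<Rightarrow> bool" where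
  "bland_le M \<sigma> a b \<longleftrightarrow> b \<le> a"

definition dantzig_le :: "mdp \<Rightarrow> (nat \<Rightarrow> nat) \<Rightarrow> nat \<Rightarrow> nat \<Rightarrow> bool" where
  "dantzig_le M \<sigma> a b \<longleftrightarrow> rc M \<sigma> a \<le> rc M \<sigma> b"

definition li_le :: "mdp \<Rightarrow> (nat \<Rightarrow> nat) \<Rightarrow> nat \<Rightarrow> nat \<Rightarrow> bool" where
  "li_le M \<sigma> a b \<longleftrightarrow>
     (\<Sum>s \<in> St M. val M (switch M \<sigma> a) s) \<le> (\<Sum>s \<in> St M. val M (switch M \<sigma> b) s)"

text \<open>Domain of a pivot rule: non-optimal weak unichain policies of a process.\<close>
definition pivot_dom :: "mdp \<Rightarrow> (nat \<Rightarrow> nat) \<Rightarrow> bool" where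
  "pivot_dom M \<sigma> \<longleftrightarrow> is_mdp M \<and> weak_unichain_policy M \<sigma> \<and> improving M \<sigma> \<noteq> {}"

text \<open>A deterministic memoryless pivot rule.\<close>
definition pivot_rule :: "(mdp \<Rightarrow> (nat \<Rightarrow> nat) \<Rightarrow> nat) \<Rightarrow> bool" where
  "pivot_rule \<Pi> \<longleftrightarrow> (\<forall>M \<sigma>. pivot_dom M \<sigma> \<longrightarrow> \<Pi> M \<sigma> \<in> improving M \<sigma>)"

definition ranking_based :: "(mdp \<Rightarrow> (nat \<Rightarrow> nat) \<Rightarrow> nat) \<Rightarrow> bool" where
  "ranking_based \<Pi> \<longleftrightarrow>
     (\<forall>M \<sigma> M' \<sigma>' \<phi>. pivot_dom M \<sigma> \<and> pivot_dom M' \<sigma>' \<and>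
        bij_betw \<phi> (improving M \<sigma>) (improving M' \<sigma>') \<and>
        (\<forall>a \<in> improving M \<sigma>. \<forall>b \<in> improving M \<sigma>.
           (bland_le M \<sigma> a b \<longleftrightarrow> bland_le M' \<sigma>' (\<phi> a) (\<phi> b)) \<and>
           (dantzig_le M \<sigma> a b \<longleftrightarrow> dantzig_le M' \<sigma>' (\<phi> a) (\<phi> b)) \<and>
           (li_le M \<sigma> a b \<longleftrightarrow> li_le M' \<sigma>' (\<phi> a) (\<phi> b)))
        \<longrightarrow> \<Pi> M' \<sigma>' = \<phi> (\<Pi> M \<sigma>))"

text \<open>The policy after j iterations of PolicyIteration (stays put once no improving switch exists).\<close>
primrec pi_iter :: "mdp \<Rightarrow> (mdp \<Rightarrow> (nat \<Rightarrow> nat) \<Rightarrow> nat) \<Rightarrow> (nat \<Rightarrow> nat) \<Rightarrow> nat \<Rightarrow> (nat \<Rightarrow> nat)" where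
  "pi_iter M \<Pi> \<sigma>0 0 = \<sigma>0"
| "pi_iter M \<Pi> \<sigma>0 (Suc j) =
     (let \<sigma> = pi_iter M \<Pi> \<sigma>0 j in
      if improving M \<sigma> = {} then \<sigma> else switch M \<sigma> (\<Pi> M \<sigma>))"

text \<open>Number N of non-zero transition probabilities.\<close>
definition num_trans :: "mdp \<Rightarrow> nat" where
  "num_trans M = card {(a, t). a \<in> Act M \<and> t \<in> St M \<and> prob M a t \<noteq> 0}"

end

theory Submission
  imports Defs
begin

text \<open>
  When \<open>k\<close> switches are improving and the three rankings agree on them, a ranking-based rule can only
  choose by position: it takes the switch that has exactly \<open>pick \<Pi> k\<close> better ones, where \<open>pick \<Pi>\<close> is
  arbitrary apart from \<open>pick \<Pi> k < k\<close>. The process is tailored to this function.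

  It is a Gray-code counter with \<open>n\<close> levels. At each level a state \<open>C\<close> chooses between two ports, and
  moving it to the better port reverses, at the next level, which port is the better one. A move takes three
  switches (open the path to the better port, move, close the old path), and opening or closing a path
  gains a freely chosen tiny amount \<open>gam i\<close>. While the counter works at level \<open>i\<close>, exactly
  the levels \<open>j \<le> i\<close> have an improving switch, one each, and the counter advances as long as the switch of
  level \<open>i\<close> is the one selected.

  Let \<open>low i\<close> be the minimum of \<open>g k = pick \<Pi> (k + 1)\<close> over \<open>i \<le> k < n\<close>. As \<open>low\<close> is nondecreasing with
  \<open>low i \<le> i\<close>, the \<open>gam i\<close> can be arranged such that exactly \<open>low i\<close> of the levels below \<open>i\<close> beat level \<open>i\<close>;
  and switches that are never applied, with negligible gains, raise the number of improving switches to \<open>k + 1\<close>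
  for some \<open>k \<ge> i\<close> with \<open>g k = low i\<close>. Hence \<open>\<Pi>\<close> always selects the switch of level \<open>i\<close>, and the counter
  makes \<open>3 * (2 ^ n - 1)\<close> steps with only \<open>O(n)\<close> transitions.
\<close>

section \<open>Policies that reach the sink\<close>

definition pol_edges :: "mdp \<Rightarrow> (nat \<Rightarrow> nat) \<Rightarrow> (nat \<times> nat) set" where
  "pol_edges M \<sigma> = {(s, t). s \<in> St M \<and> prob M (\<sigma> s) t > 0}"

text \<open>Reachability in the graph of the policy replaces the limit in
  \<open>weak_unichain_policy\<close>, so that concrete policies are checked without limits;
  \<open>proper_weak_unichain\<close> recovers the limit.\<close>

definition proper :: "mdp \<Rightarrow> (nat \<Rightarrow> nat) \<Rightarrow> bool" where
  "proper M \<sigma> \<longleftrightarrow> policy M \<sigma> \<and> (\<forall>s \<in> St M. (s, sink M) \<in> (pol_edges M \<sigma>)\<^sup>*)"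

lemma policy_Act: "is_mdp M \<Longrightarrow> policy M \<sigma> \<Longrightarrow> s \<in> St M \<Longrightarrow> \<sigma> s \<in> Act M"
  by (auto simp: is_mdp_def policy_def)

lemma mdp_prob:
  assumes "is_mdp M" "a \<in> Act M"
  shows "prob M a t \<ge> 0" "t \<notin> St M \<Longrightarrow> prob M a t = 0" "(\<Sum>t \<in> St M. prob M a t) = 1"
  using assms unfolding is_mdp_def by blast+

lemma st_of_eq: "is_mdp M \<Longrightarrow> s \<in> St M \<Longrightarrow> a \<in> Av M s \<Longrightarrow> st_of M a = s"
  unfolding st_of_def is_mdp_def by (intro the_equality) blast+

text \<open>A positive maximum of \<open>h\<close> is passed on to every successor, because there
  \<open>h\<close> is at most its average; along the path to the sink this contradicts
  \<open>h (sink M) \<le> 0\<close>. The alternative \<open>h s \<le> 0\<close> in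
  \<open>sub\<close> exempts single states, which \<open>switch_gain\<close> uses at the switched
  state.\<close>

lemma max_principle:
  fixes h :: "nat \<Rightarrow> real"
  assumes M: "is_mdp M" and \<sigma>: "proper M \<sigma>"
    and sink: "h (sink M) \<le> 0"
    and sub: "\<And>s. s \<in> St M \<Longrightarrow> s \<noteq> sink M \<Longrightarrow> h s \<le> (\<Sum>t \<in> St M. prob M (\<sigma> s) t * h t) \<or> h s \<le> 0"
    and s: "s \<in> St M"
  shows "h s \<le> 0"
proof (rule ccontr)
  assume "\<not> h s \<le> 0"
  define m where "m = Max (h ` St M)"
  have fin: "finite (St M)" using M by (simp add: is_mdp_def)
  have le: "h t \<le> m" if "t \<in> St M" for t using that fin by (simp add: m_def)
  have "m > 0" using le[OF s] \<open>\<not> h s \<le> 0\<close> by linarith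
  have "m \<in> h ` St M" unfolding m_def using fin s by (intro Max_in) auto
  then obtain z where z: "z \<in> St M" "h z = m" by auto
  have step: "t \<in> St M \<and> h t = m" if "(y, t) \<in> pol_edges M \<sigma>" "h y = m" for y t
  proof -
    have y: "y \<in> St M" and p: "prob M (\<sigma> y) t > 0" using that by (auto simp: pol_edges_def)
    have act: "\<sigma> y \<in> Act M" using policy_Act[OF M _ y] \<sigma> by (auto simp: proper_def)
    note P = mdp_prob[OF M act]
    have t: "t \<in> St M" using P(2)[of t] p by (cases "t \<in> St M") auto
    have "y \<noteq> sink M" using sink that \<open>m > 0\<close> by auto
    then have "m \<le> (\<Sum>t \<in> St M. prob M (\<sigma> y) t * h t)" using sub[OF y] that \<open>m > 0\<close> by auto
    also have "\<dots> = (\<Sum>t \<in> St M. prob M (\<sigma> y) t * m) - (\<Sum>t \<in> St M. prob M (\<sigma> y) t * (m - h t))"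
      by (simp add: algebra_simps sum_subtractf)
    also have "(\<Sum>t \<in> St M. prob M (\<sigma> y) t * m) = m" using P(3) by (simp flip: sum_distrib_right)
    finally have "(\<Sum>t \<in> St M. prob M (\<sigma> y) t * (m - h t)) \<le> 0" by linarith
    moreover have nn: "prob M (\<sigma> y) u * (m - h u) \<ge> 0" if "u \<in> St M" for u using P(1) le[OF that] by simp
    ultimately have "(\<Sum>t \<in> St M. prob M (\<sigma> y) t * (m - h t)) = 0"
      by (intro antisym sum_nonneg) auto
    then have "prob M (\<sigma> y) t * (m - h t) = 0"
      using sum_nonneg_eq_0_iff[OF fin nn] t by auto
    then show ?thesis using p t by simp
  qed
  have "(z, sink M) \<in> (pol_edges M \<sigma>)\<^sup>*" using \<sigma> z by (auto simp: proper_def)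
  then have "h (sink M) = m" by (induction rule: rtrancl_induct) (use z step in auto)
  then show False using sink \<open>m > 0\<close> by linarith
qed

section \<open>Values as unique solutions of the value equations\<close>

definition bellman :: "mdp \<Rightarrow> (nat \<Rightarrow> nat) \<Rightarrow> (nat \<Rightarrow> real) \<Rightarrow> bool" where
  "bellman M \<sigma> v \<longleftrightarrow> (\<forall>s. s \<notin> St M \<longrightarrow> v s = 0) \<and> v (sink M) = 0 \<and>
       (\<forall>s \<in> St M. v s = rew M (\<sigma> s) + (\<Sum>t \<in> St M. prob M (\<sigma> s) t * v t))"

lemma bellman_diff:
  assumes "bellman M \<sigma> v" "bellman M \<tau> w" "s \<in> St M" "\<sigma> s = \<tau> s"
  shows "v s - w s = (\<Sum>t \<in> St M. prob M (\<sigma> s) t * (v t - w t))"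
proof -
  have "v s = rew M (\<sigma> s) + (\<Sum>t \<in> St M. prob M (\<sigma> s) t * v t)"
    "w s = rew M (\<sigma> s) + (\<Sum>t \<in> St M. prob M (\<sigma> s) t * w t)"
    using assms unfolding bellman_def by metis+
  then show ?thesis unfolding right_diff_distrib sum_subtractf by linarith
qed

lemma bellman_unique:
  assumes M: "is_mdp M" and \<sigma>: "proper M \<sigma>" and v: "bellman M \<sigma> v" and w: "bellman M \<sigma> w"
  shows "v = w"
proof
  have le: "v' s \<le> w' s" if "s \<in> St M" "bellman M \<sigma> v'" "bellman M \<sigma> w'" for s v' w'
  proof -
    have "v' s - w' s \<le> 0"
      by (rule max_principle[OF M \<sigma>, where h = "\<lambda>s. v' s - w' s"])
        (use that bellman_diff[OF that(2,3)] in \<open>auto simp: bellman_def\<close>)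
    then show ?thesis by simp
  qed
  fix s
  show "v s = w s"
  proof (cases "s \<in> St M")
    case True
    then show ?thesis using le v w by (meson antisym)
  next
    case False
    then show ?thesis using v w by (simp add: bellman_def)
  qed
qed

lemma val_eqI:
  assumes "is_mdp M" "proper M \<sigma>" "bellman M \<sigma> v"
  shows "val M \<sigma> = v"
  unfolding val_def using assms bellman_unique[OF assms(1,2)]
  by (intro the_equality) (auto simp: bellman_def[symmetric])

section \<open>Probability of reaching the sink, and optimality\<close>

lemma dist_nonneg: "is_mdp M \<Longrightarrow> policy M \<sigma> \<Longrightarrow> s \<in> St M \<Longrightarrow> dist M \<sigma> n s t \<ge> 0"
  by (induction n arbitrary: t) (auto intro!: sum_nonneg mult_nonneg_nonneg mdp_prob(1) dest: policy_Act)

lemma dist_sum: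
  assumes M: "is_mdp M" and \<sigma>: "policy M \<sigma>" and s: "s \<in> St M"
  shows "(\<Sum>t \<in> St M. dist M \<sigma> n s t) = 1"
proof (induction n)
  case 0
  then show ?case using M s by (simp add: is_mdp_def sum.delta)
next
  case (Suc n)
  have "(\<Sum>t \<in> St M. dist M \<sigma> (Suc n) s t) = (\<Sum>u \<in> St M. dist M \<sigma> n s u * (\<Sum>t \<in> St M. prob M (\<sigma> u) t))"
    by (simp add: sum_distrib_left) (rule sum.swap)
  also have "\<dots> = 1" using Suc mdp_prob(3)[OF M policy_Act[OF M \<sigma>]] by simp
  finally show ?case .
qed

text \<open>\<open>dist\<close> appends a last step; an equation between limits for different start
  states needs the first step split off instead.\<close>

lemma dist_first_step:
  assumes M: "is_mdp M" and \<sigma>: "policy M \<sigma>" and s: "s \<in> St M"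
  shows "t \<in> St M \<Longrightarrow> dist M \<sigma> (Suc n) s t = (\<Sum>u \<in> St M. prob M (\<sigma> s) u * dist M \<sigma> n u t)"
proof (induction n arbitrary: t)
  case 0
  have fin: "finite (St M)" using M by (simp add: is_mdp_def)
  have "dist M \<sigma> (Suc 0) s t = (\<Sum>u \<in> St M. if s = u then prob M (\<sigma> u) t else 0)"
    by (auto intro!: sum.cong)
  also have "\<dots> = prob M (\<sigma> s) t" using s fin by simp
  also have "\<dots> = (\<Sum>u \<in> St M. if u = t then prob M (\<sigma> s) u else 0)" using 0 fin by simp
  also have "\<dots> = (\<Sum>u \<in> St M. prob M (\<sigma> s) u * dist M \<sigma> 0 u t)" by (auto intro!: sum.cong)
  finally show ?case .
next
  case (Suc n)
  have "dist M \<sigma> (Suc (Suc n)) s t = (\<Sum>v \<in> St M. dist M \<sigma> (Suc n) s v * prob M (\<sigma> v) t)" by simp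
  also have "\<dots> = (\<Sum>v \<in> St M. (\<Sum>u \<in> St M. prob M (\<sigma> s) u * dist M \<sigma> n u v) * prob M (\<sigma> v) t)"
    using Suc.IH by (intro sum.cong refl) metis
  also have "\<dots> = (\<Sum>v \<in> St M. \<Sum>u \<in> St M. prob M (\<sigma> s) u * (dist M \<sigma> n u v * prob M (\<sigma> v) t))"
    by (simp add: sum_distrib_right mult.assoc)
  also have "\<dots> = (\<Sum>u \<in> St M. prob M (\<sigma> s) u * dist M \<sigma> (Suc n) u t)"
    by (subst sum.swap) (simp add: sum_distrib_left)
  finally show ?case .
qed

lemma mdp_sink:
  assumes M: "is_mdp M" and \<sigma>: "policy M \<sigma>"
  shows "sink M \<in> St M" "prob M (\<sigma> (sink M)) (sink M) = 1" "rew M (\<sigma> (sink M)) = 0"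
  using assms unfolding is_mdp_def policy_def by (blast, fastforce, fastforce)

text \<open>The probability of being in the absorbing sink is nondecreasing in time, so it has a
  limit \<open>L\<close>. The first-step equation makes \<open>L\<close> harmonic with
  \<open>L (sink M) = 1\<close>, and the maximum principle for \<open>1 - L\<close> and
  \<open>L - 1\<close> forces \<open>L = 1\<close>.\<close>

lemma proper_weak_unichain:
  assumes M: "is_mdp M" and \<sigma>: "proper M \<sigma>"
  shows "weak_unichain_policy M \<sigma>"
proof -
  have pol: "policy M \<sigma>" using \<sigma> by (simp add: proper_def)
  have fin: "finite (St M)" using M by (simp add: is_mdp_def)
  note sk = mdp_sink[OF M pol]
  define L where "L s = lim (\<lambda>n. dist M \<sigma> n s (sink M))" for s
  have lim: "(\<lambda>n. dist M \<sigma> n s (sink M)) \<longlonglongrightarrow> L s" if s: "s \<in> St M" for s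
  proof -
    have "incseq (\<lambda>n. dist M \<sigma> n s (sink M))"
    proof (rule incseq_SucI)
      fix n
      have "dist M \<sigma> n s (sink M) * prob M (\<sigma> (sink M)) (sink M) \<le> dist M \<sigma> (Suc n) s (sink M)"
        unfolding dist.simps
        by (rule member_le_sum) (use sk fin in \<open>auto intro!: mult_nonneg_nonneg dist_nonneg[OF M pol s] mdp_prob(1)[OF M policy_Act[OF M pol]]\<close>)
      then show "dist M \<sigma> n s (sink M) \<le> dist M \<sigma> (Suc n) s (sink M)" using sk by simp
    qed
    moreover have "dist M \<sigma> n s (sink M) \<le> 1" for n
      using member_le_sum[of "sink M" "St M" "dist M \<sigma> n s"] dist_sum[OF M pol s, of n]
        dist_nonneg[OF M pol s] sk fin by simp
    ultimately have "convergent (\<lambda>n. dist M \<sigma> n s (sink M))"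
      using incseq_convergent[of "\<lambda>n. dist M \<sigma> n s (sink M)" 1] unfolding convergent_def by metis
    then show ?thesis by (simp add: L_def convergent_LIMSEQ_iff)
  qed
  have eq: "L s = (\<Sum>u \<in> St M. prob M (\<sigma> s) u * L u)" if s: "s \<in> St M" for s
  proof -
    have "(\<lambda>n. dist M \<sigma> (Suc n) s (sink M)) \<longlonglongrightarrow> (\<Sum>u \<in> St M. prob M (\<sigma> s) u * L u)"
      unfolding dist_first_step[OF M pol s sk(1)] by (intro tendsto_sum tendsto_mult tendsto_const lim)
    then show ?thesis using LIMSEQ_Suc[OF lim[OF s]] LIMSEQ_unique by blast
  qed
  have one: "dist M \<sigma> n (sink M) (sink M) = 1" for n
  proof (induction n)
    case (Suc n)
    have p0: "prob M (\<sigma> (sink M)) u = 0" if "u \<in> St M" "u \<noteq> sink M" for u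
    proof -
      have "(\<Sum>u \<in> St M - {sink M}. prob M (\<sigma> (sink M)) u) = 0"
        using mdp_prob(3)[OF M policy_Act[OF M pol sk(1)]] sum.remove[OF fin sk(1), of "prob M (\<sigma> (sink M))"] sk by simp
      then show ?thesis
        using sum_nonneg_eq_0_iff[of "St M - {sink M}" "prob M (\<sigma> (sink M))"] fin that
          mdp_prob(1)[OF M policy_Act[OF M pol sk(1)]] by auto
    qed
    have "dist M \<sigma> (Suc n) (sink M) (sink M) = (\<Sum>u \<in> St M. if u = sink M then 1 else 0)"
      unfolding dist_first_step[OF M pol sk(1) sk(1)] using p0 Suc sk by (intro sum.cong) auto
    then show ?case using fin sk by simp
  qed auto
  have "L (sink M) = 1" using LIMSEQ_unique[OF lim[OF sk(1)]] one by simp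
  have bound: "1 - L s \<le> 0" "L s - 1 \<le> 0" if s: "s \<in> St M" for s
  proof -
    have *: "(\<Sum>u \<in> St M. prob M (\<sigma> t) u * (1 - L u)) = 1 - L t" if "t \<in> St M" for t
      using eq[OF that] mdp_prob(3)[OF M policy_Act[OF M pol that]]
      by (simp add: right_diff_distrib sum_subtractf)
    have **: "(\<Sum>u \<in> St M. prob M (\<sigma> t) u * (L u - 1)) = L t - 1" if "t \<in> St M" for t
      using eq[OF that] mdp_prob(3)[OF M policy_Act[OF M pol that]]
      by (simp add: right_diff_distrib sum_subtractf)
    show "1 - L s \<le> 0" by (rule max_principle[OF M \<sigma> _ _ s]) (use \<open>L (sink M) = 1\<close> * in auto)
    show "L s - 1 \<le> 0" by (rule max_principle[OF M \<sigma> _ _ s]) (use \<open>L (sink M) = 1\<close> ** in auto)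
  qed
  have "L s = 1" if "s \<in> St M" for s using bound[OF that] by simp
  then show ?thesis using lim pol unfolding weak_unichain_policy_def by metis
qed

text \<open>By induction, the reward of \<open>n\<close> steps plus the expected \<open>v\<close> at
  the state then reached never exceeds \<open>v s\<close>; nonnegativity of \<open>v\<close> allows
  dropping the second term. Hence the bound also covers policies that never reach the sink.\<close>

lemma fin_reward_le:
  fixes v :: "nat \<Rightarrow> real"
  assumes M: "is_mdp M" and \<tau>: "policy M \<tau>" and s: "s \<in> St M"
    and v0: "\<And>s. s \<in> St M \<Longrightarrow> v s \<ge> 0"
    and opt: "\<And>s a. s \<in> St M \<Longrightarrow> a \<in> Av M s \<Longrightarrow> rew M a + (\<Sum>t \<in> St M. prob M a t * v t) \<le> v s"
  shows "fin_reward M \<tau> n s \<le> v s"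
proof -
  have fin: "finite (St M)" using M by (simp add: is_mdp_def)
  have "fin_reward M \<tau> n s + (\<Sum>t \<in> St M. dist M \<tau> n s t * v t) \<le> v s"
  proof (induction n)
    case 0
    have "(\<Sum>t \<in> St M. dist M \<tau> 0 s t * v t) = (\<Sum>t \<in> St M. if t = s then v t else 0)"
      by (intro sum.cong) auto
    then show ?case using s fin by (simp add: fin_reward_def)
  next
    case (Suc n)
    have "(\<Sum>t \<in> St M. dist M \<tau> (Suc n) s t * v t)
        = (\<Sum>t \<in> St M. \<Sum>u \<in> St M. dist M \<tau> n s u * (prob M (\<tau> u) t * v t))"
      by (simp add: sum_distrib_right mult.assoc)
    also have "\<dots> = (\<Sum>u \<in> St M. dist M \<tau> n s u * (\<Sum>t \<in> St M. prob M (\<tau> u) t * v t))"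
      by (subst sum.swap) (simp add: sum_distrib_left)
    finally have "fin_reward M \<tau> (Suc n) s + (\<Sum>t \<in> St M. dist M \<tau> (Suc n) s t * v t)
      = fin_reward M \<tau> n s + (\<Sum>u \<in> St M. dist M \<tau> n s u * (rew M (\<tau> u) + (\<Sum>t \<in> St M. prob M (\<tau> u) t * v t)))"
      by (simp add: fin_reward_def distrib_left sum.distrib)
    also have "\<dots> \<le> fin_reward M \<tau> n s + (\<Sum>u \<in> St M. dist M \<tau> n s u * v u)"
      using \<tau> dist_nonneg[OF M \<tau> s]
      by (intro add_left_mono sum_mono mult_left_mono opt) (auto simp: policy_def)
    finally show ?case using Suc by linarith
  qed
  moreover have "(\<Sum>t \<in> St M. dist M \<tau> n s t * v t) \<ge> 0"
    using v0 dist_nonneg[OF M \<tau> s] by (intro sum_nonneg) auto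
  ultimately show ?thesis by linarith
qed

lemma optimal_policyI:
  assumes M: "is_mdp M" and \<sigma>: "proper M \<sigma>" and imp: "improving M \<sigma> = {}"
    and v0: "\<And>s. s \<in> St M \<Longrightarrow> val M \<sigma> s \<ge> 0"
  shows "optimal_policy M \<sigma>"
proof -
  have "rew M a + (\<Sum>t \<in> St M. prob M a t * val M \<sigma> t) \<le> val M \<sigma> s"
    if "s \<in> St M" "a \<in> Av M s" for s a
  proof -
    have "a \<in> Act M" using that M by (auto simp: is_mdp_def)
    then have "\<not> rc M \<sigma> a > 0" using imp by (auto simp: improving_def)
    then show ?thesis using st_of_eq[OF M that] by (simp add: rc_def)
  qed
  then have "fin_reward M \<tau> n s \<le> val M \<sigma> s" if "policy M \<tau>" "s \<in> St M" for \<tau> n s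
    using fin_reward_le[OF M that, where v = "val M \<sigma>"] v0 by blast
  then have "limsup (\<lambda>n. ereal (fin_reward M \<tau> n s)) \<le> ereal (val M \<sigma> s)"
    if "policy M \<tau>" "s \<in> St M" for \<tau> s
    using that by (intro Limsup_bounded) auto
  then show ?thesis using proper_weak_unichain[OF M \<sigma>] by (auto simp: optimal_policy_def)
qed

text \<open>The increase \<open>v' - v\<close> is harmonic away from \<open>s\<close> for the new
  policy and zero at the sink, so it lies everywhere between 0 and its value at \<open>s\<close>.
  The LargestIncrease measure is therefore known up to the factor
  \<open>card (St M)\<close>.\<close>

lemma switch_gain:
  assumes M: "is_mdp M" and \<sigma>': "proper M (\<sigma>(s := a))"
    and v: "bellman M \<sigma> v" and v': "bellman M (\<sigma>(s := a)) v'"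
    and s: "s \<in> St M" and gain: "v' s \<ge> v s"
  shows "(\<Sum>t \<in> St M. v' t) - (\<Sum>t \<in> St M. v t) \<ge> v' s - v s"
    and "(\<Sum>t \<in> St M. v' t) - (\<Sum>t \<in> St M. v t) \<le> real (card (St M)) * (v' s - v s)"
proof -
  have fin: "finite (St M)" using M by (simp add: is_mdp_def)
  define u where "u t = v' t - v t" for t
  have u: "u t = (\<Sum>r \<in> St M. prob M ((\<sigma>(s := a)) t) r * u r)" if "t \<in> St M" "t \<noteq> s" for t
    using bellman_diff[OF v' v that(1)] that(2) by (simp add: u_def)
  have u0: "u (sink M) = 0" using v v' by (auto simp: bellman_def u_def)
  have us: "u s \<ge> 0" using gain by (simp add: u_def)
  have pos: "u t \<ge> 0" if "t \<in> St M" for t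
  proof -
    have "- u t \<le> 0"
    proof (rule max_principle[OF M \<sigma>' _ _ that])
      fix r assume "r \<in> St M" "r \<noteq> sink M"
      then show "- u r \<le> (\<Sum>t\<in>St M. prob M ((\<sigma>(s := a)) r) t * - u t) \<or> - u r \<le> 0"
        using us u[of r] by (cases "r = s") (auto simp: sum_negf)
    qed (simp add: u0)
    then show ?thesis by simp
  qed
  have ub: "u t \<le> u s" if "t \<in> St M" for t
  proof -
    have "u t - u s \<le> 0"
    proof (rule max_principle[OF M \<sigma>' _ _ that])
      show "u (sink M) - u s \<le> 0" using u0 us by simp
      fix r assume r: "r \<in> St M" "r \<noteq> sink M"
      show "u r - u s \<le> (\<Sum>t\<in>St M. prob M ((\<sigma>(s := a)) r) t * (u t - u s)) \<or> u r - u s \<le> 0"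
      proof (cases "r = s")
        case False
        have "(\<sigma>(s := a)) r \<in> Act M" using policy_Act[OF M _ r(1)] \<sigma>' unfolding proper_def by blast
        then have "(\<Sum>t\<in>St M. prob M ((\<sigma>(s := a)) r) t * (u t - u s)) = u r - u s"
          unfolding right_diff_distrib sum_subtractf
          using u[OF r(1) False] mdp_prob(3)[OF M] by (simp flip: sum_distrib_right)
        then show ?thesis by simp
      qed auto
    qed
    then show ?thesis by simp
  qed
  have "(\<Sum>t \<in> St M. v' t) - (\<Sum>t \<in> St M. v t) = (\<Sum>t \<in> St M. u t)"
    by (simp add: u_def sum_subtractf)
  moreover have "u s \<le> (\<Sum>t \<in> St M. u t)" using member_le_sum[OF s] pos fin by auto
  moreover have "(\<Sum>t \<in> St M. u t) \<le> real (card (St M)) * u s" using ub sum_bounded_above[of "St M" u "u s"] by simp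
  ultimately show "(\<Sum>t \<in> St M. v' t) - (\<Sum>t \<in> St M. v t) \<ge> v' s - v s"
    "(\<Sum>t \<in> St M. v' t) - (\<Sum>t \<in> St M. v t) \<le> real (card (St M)) * (v' s - v s)"
    by (auto simp: u_def)
qed

section \<open>Agreeing rankings\<close>

definition agree :: "mdp \<Rightarrow> (nat \<Rightarrow> nat) \<Rightarrow> bool" where
  "agree M \<sigma> \<longleftrightarrow> pivot_dom M \<sigma> \<and>
     (\<forall>a \<in> improving M \<sigma>. \<forall>b \<in> improving M \<sigma>.
        (dantzig_le M \<sigma> a b \<longleftrightarrow> bland_le M \<sigma> a b) \<and> (li_le M \<sigma> a b \<longleftrightarrow> bland_le M \<sigma> a b))"

text \<open>For a ranking-based rule the rank does not depend on the witness that
  \<open>SOME\<close> takes, by \<open>ranking_based_rank\<close>. The default 0 keeps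
  \<open>pick_less\<close> true for sizes that no agreeing policy realizes.\<close>

definition pick :: "(mdp \<Rightarrow> (nat \<Rightarrow> nat) \<Rightarrow> nat) \<Rightarrow> nat \<Rightarrow> nat" where
  "pick \<Pi> k = (if \<exists>r M \<sigma>. agree M \<sigma> \<and> card (improving M \<sigma>) = k \<and> r = card {b \<in> improving M \<sigma>. b < \<Pi> M \<sigma>}
     then (SOME r. \<exists>M \<sigma>. agree M \<sigma> \<and> card (improving M \<sigma>) = k \<and> r = card {b \<in> improving M \<sigma>. b < \<Pi> M \<sigma>})
     else 0)"

lemma finite_improving: "is_mdp M \<Longrightarrow> finite (improving M \<sigma>)"
  unfolding improving_def is_mdp_def by (intro finite_subset[of "{a \<in> Act M. 0 < rc M \<sigma> a}" "Act M"]) blast+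

lemma order_iso_finite_nat:
  fixes A B :: "nat set"
  assumes "finite A" "finite B" "card A = card B"
  obtains \<phi> where "bij_betw \<phi> A B" "\<And>a b. a \<in> A \<Longrightarrow> b \<in> A \<Longrightarrow> \<phi> a < \<phi> b \<longleftrightarrow> a < b"
proof -
  obtain p where p: "bij_betw p {..<card A} A" "strict_mono_on {..<card A} p"
    using ex_bij_betw_strict_mono_card[OF assms(1)] by blast
  obtain q where q: "bij_betw q {..<card A} B" "strict_mono_on {..<card A} q"
    using ex_bij_betw_strict_mono_card[OF assms(2)] assms(3) by metis
  define p' where "p' = inv_into {..<card A} p"
  have p': "p' a \<in> {..<card A}" "p (p' a) = a" if "a \<in> A" for a
    using bij_betw_apply[OF bij_betw_inv_into[OF p(1)] that] bij_betw_inv_into_right[OF p(1) that]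
    by (simp_all add: p'_def)
  show thesis
  proof (rule that[of "q \<circ> p'"])
    show "bij_betw (q \<circ> p') A B"
      using bij_betw_trans[OF bij_betw_inv_into[OF p(1)] q(1)] by (simp add: p'_def)
    fix a b assume ab: "a \<in> A" "b \<in> A"
    show "(q \<circ> p') a < (q \<circ> p') b \<longleftrightarrow> a < b"
      using strict_mono_on_less[OF q(2), of "p' a" "p' b"] strict_mono_on_less[OF p(2), of "p' a" "p' b"] p' ab by simp
  qed
qed

text \<open>When all rankings follow the labels, the order isomorphism of the two sets of improving
  switches preserves all three, so the rule must commute with it.\<close>

lemma ranking_based_rank:
  assumes "pivot_rule \<Pi>" "ranking_based \<Pi>" "agree M \<sigma>" "agree M' \<sigma>'"
    and card: "card (improving M \<sigma>) = card (improving M' \<sigma>')"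
  shows "card {b \<in> improving M \<sigma>. b < \<Pi> M \<sigma>} = card {b \<in> improving M' \<sigma>'. b < \<Pi> M' \<sigma>'}"
proof -
  let ?A = "improving M \<sigma>" and ?B = "improving M' \<sigma>'"
  have dom: "pivot_dom M \<sigma>" "pivot_dom M' \<sigma>'" using assms by (auto simp: agree_def)
  have fin: "finite ?A" "finite ?B" using dom by (auto simp: pivot_dom_def finite_improving)
  obtain \<phi> where \<phi>: "bij_betw \<phi> ?A ?B"
    and less: "\<And>a b. a \<in> ?A \<Longrightarrow> b \<in> ?A \<Longrightarrow> \<phi> a < \<phi> b \<longleftrightarrow> a < b"
    using order_iso_finite_nat[OF fin card] by blast
  then have le: "\<phi> b \<le> \<phi> a \<longleftrightarrow> b \<le> a" if "a \<in> ?A" "b \<in> ?A" for a b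
    using that by (meson linorder_not_less)
  have im: "\<phi> a \<in> ?B" if "a \<in> ?A" for a using \<phi>(1) that by (auto simp: bij_betw_def)
  have "\<Pi> M' \<sigma>' = \<phi> (\<Pi> M \<sigma>)"
    using assms(2)[unfolded ranking_based_def, rule_format, of M \<sigma> M' \<sigma>' \<phi>] dom \<phi>(1) assms(3,4) im le
    by (simp add: agree_def bland_le_def)
  moreover have "\<Pi> M \<sigma> \<in> ?A" using assms(1) dom by (auto simp: pivot_rule_def)
  ultimately have "{b \<in> ?B. b < \<Pi> M' \<sigma>'} = \<phi> ` {b \<in> ?A. b < \<Pi> M \<sigma>}"
    using less \<phi> unfolding bij_betw_def by (auto 0 4 simp: image_iff) 
  moreover have "inj_on \<phi> {b \<in> ?A. b < \<Pi> M \<sigma>}"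
    using \<phi>(1) by (auto simp: bij_betw_def intro: inj_on_subset)
  ultimately show ?thesis by (simp add: card_image)
qed

lemma pick_eq:
  assumes "pivot_rule \<Pi>" "ranking_based \<Pi>" "agree M \<sigma>"
  shows "card {b \<in> improving M \<sigma>. b < \<Pi> M \<sigma>} = pick \<Pi> (card (improving M \<sigma>))"
proof -
  let ?P = "\<lambda>r. \<exists>M' \<sigma>'. agree M' \<sigma>' \<and> card (improving M' \<sigma>') = card (improving M \<sigma>) \<and> r = card {b \<in> improving M' \<sigma>'. b < \<Pi> M' \<sigma>'}"
  have ex: "\<exists>r. ?P r" using assms(3) by blast
  then have "?P (pick \<Pi> (card (improving M \<sigma>)))" unfolding pick_def using someI_ex[OF ex] by auto
  then show ?thesis using ranking_based_rank[OF assms(1,2,3)] by metis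
qed

lemma pick_less:
  assumes "pivot_rule \<Pi>" "0 < k"
  shows "pick \<Pi> k < k"
proof (cases "\<exists>r M \<sigma>. agree M \<sigma> \<and> card (improving M \<sigma>) = k \<and> r = card {b \<in> improving M \<sigma>. b < \<Pi> M \<sigma>}")
  case True
  then have "\<exists>M \<sigma>. agree M \<sigma> \<and> card (improving M \<sigma>) = k \<and> pick \<Pi> k = card {b \<in> improving M \<sigma>. b < \<Pi> M \<sigma>}"
    unfolding pick_def using someI_ex[OF True] by auto
  then obtain M \<sigma> where *: "agree M \<sigma>" "card (improving M \<sigma>) = k" "pick \<Pi> k = card {b \<in> improving M \<sigma>. b < \<Pi> M \<sigma>}"
    by blast
  then have dom: "pivot_dom M \<sigma>" by (simp add: agree_def)
  then have "\<Pi> M \<sigma> \<in> improving M \<sigma>" using assms(1) by (auto simp: pivot_rule_def)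
  then have "{b \<in> improving M \<sigma>. b < \<Pi> M \<sigma>} \<subset> improving M \<sigma>" by auto
  then show ?thesis using * dom psubset_card_mono finite_improving by (metis pivot_dom_def)
next
  case False
  then show ?thesis using assms(2) by (auto simp: pick_def)
qed

lemma rule_eqI:
  assumes "pivot_rule \<Pi>" "ranking_based \<Pi>" "agree M \<sigma>" and x: "x \<in> improving M \<sigma>"
    and rank: "card {b \<in> improving M \<sigma>. b < x} = pick \<Pi> (card (improving M \<sigma>))"
  shows "\<Pi> M \<sigma> = x"
proof (rule ccontr)
  assume "\<Pi> M \<sigma> \<noteq> x"
  have dom: "pivot_dom M \<sigma>" using assms by (simp add: agree_def)
  have fin: "finite (improving M \<sigma>)" using dom by (auto simp: pivot_dom_def finite_improving)
  have mono: "card {b \<in> improving M \<sigma>. b < y} < card {b \<in> improving M \<sigma>. b < z}"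
    if "y < z" "y \<in> improving M \<sigma>" for y z
    by (rule psubset_card_mono) (use that fin in auto)
  have "\<Pi> M \<sigma> \<in> improving M \<sigma>" using assms(1) dom by (auto simp: pivot_rule_def)
  then show False
    using mono[of "\<Pi> M \<sigma>" x] mono[of x "\<Pi> M \<sigma>"] x pick_eq[OF assms(1-3)] rank \<open>\<Pi> M \<sigma> \<noteq> x\<close>
    by linarith
qed

section \<open>Arranging the levels\<close>

locale counter =
  fixes n :: nat and g :: "nat \<Rightarrow> nat"
  assumes g_le: "\<And>k. g k \<le> k"
begin

definition low :: "nat \<Rightarrow> nat" where "low i = Min (g ` {i..<n})"
definition height :: "nat \<Rightarrow> nat" where "height i = i - low i"
text \<open>When level \<open>i\<close> is inserted directly below the \<open>low i\<close> best of its predecessors, the predecessors that it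
  beats form a stack of size \<open>height i\<close>; \<open>cover j\<close> is the level at which \<open>j\<close> is popped, that is, from which on
  \<open>j\<close> beats all new levels.\<close>

definition cover :: "nat \<Rightarrow> nat" where "cover j = (LEAST i. j < i \<and> (n \<le> i \<or> height i \<le> height j))"
text \<open>As \<open>low\<close> is nondecreasing, levels below \<open>n\<close> with equal
  \<open>low\<close> form intervals; for \<open>j < n\<close> this is the first level of the
  interval of \<open>j\<close>.\<close>

definition start :: "nat \<Rightarrow> nat" where "start j = (LEAST i. low i = low j)"

lemma low_le_g: "i \<le> k \<Longrightarrow> k < n \<Longrightarrow> low i \<le> g k"
  by (simp add: low_def)

lemma low_le: "i < n \<Longrightarrow> low i \<le> i"
  using low_le_g[of i i] g_le[of i] by simp

lemma low_mono: "i \<le> j \<Longrightarrow> j < n \<Longrightarrow> low i \<le> low j"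
  unfolding low_def by (intro Min_antimono) auto

lemma cover_props: "j < cover j" "n \<le> cover j \<or> height (cover j) \<le> height j"
  and cover_le: "j < i \<Longrightarrow> n \<le> i \<or> height i \<le> height j \<Longrightarrow> cover j \<le> i"
proof -
  have "j < cover j \<and> (n \<le> cover j \<or> height (cover j) \<le> height j)"
    \<comment> \<open>The disjunct \<open>n \<le> i\<close> provides a candidate, so everything
      still on the stack is popped at \<open>n\<close>.\<close>
    unfolding cover_def by (rule LeastI[of _ "Suc (j + n)"]) simp
  then show "j < cover j" "n \<le> cover j \<or> height (cover j) \<le> height j" by auto
  show "j < i \<Longrightarrow> n \<le> i \<or> height i \<le> height j \<Longrightarrow> cover j \<le> i"
    unfolding cover_def by (rule Least_le) simp
qed

lemma cover_le_n: "j < n \<Longrightarrow> cover j \<le> n"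
  by (rule cover_le) auto

lemma cover_gt_iff: "i < n \<Longrightarrow> j < i \<Longrightarrow> i < cover j \<longleftrightarrow> (\<forall>k. j < k \<and> k \<le> i \<longrightarrow> height j < height k)"
  using cover_props[of j] cover_le[of j] by (meson leD le_trans linorder_not_less order_le_less_trans)

text \<open>While \<open>j\<close> is on the stack, \<open>height j < height i\<close>, so whatever
  pops \<open>j\<close> later pops \<open>i\<close> as well.\<close>

lemma cover_nested:
  assumes "j < i" "i < cover j" "i < n" shows "cover i \<le> cover j"
  using cover_le[of i "cover j"] cover_props[of j] cover_gt_iff[of i j] assms by force

lemma height_Suc: "Suc i < n \<Longrightarrow> height (Suc i) \<le> Suc (height i)"
  using low_mono[of i "Suc i"] by (simp add: height_def)

text \<open>\<open>height\<close> grows by at most one per level, so pushing \<open>i\<close> and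
  popping all heights from \<open>height (Suc i)\<close> on leaves no hole in the range of
  heights.\<close>

lemma bij_height:
  assumes "i < n"
  shows "bij_betw height {j. j < i \<and> i < cover j} {..<height i}"
  using assms
proof (induction i)
  case 0
  then show ?case using low_le[of 0] by (auto simp: height_def bij_betw_def)
next
  case (Suc i)
  have eq: "{j. j < Suc i \<and> Suc i < cover j} = {j \<in> insert i {j. j < i \<and> i < cover j}. height j < height (Suc i)}"
    using Suc.prems cover_gt_iff[of "Suc i"] cover_gt_iff[of i] by (auto simp: le_Suc_eq less_Suc_eq)
  have "bij_betw height (insert i {j. j < i \<and> i < cover j}) (insert (height i) {..<height i})"
    using Suc by (subst notIn_Un_bij_betw3[of i _ height "{..<height i}", simplified Un_insert_right Un_empty_right, symmetric]) auto
  then have b: "bij_betw height (insert i {j. j < i \<and> i < cover j}) {..<Suc (height i)}"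
    by (simp add: lessThan_Suc)
  show ?case unfolding eq
    using b height_Suc[OF Suc.prems] unfolding bij_betw_def
    by (auto simp: inj_on_def image_iff set_eq_iff subset_eq) (metis less_le_trans lessThan_iff)
qed

lemma card_cover_le:
  assumes "i < n" shows "card {j. j < i \<and> cover j \<le> i} = low i"
proof -
  have "{j. j < i \<and> cover j \<le> i} = {..<i} - {j. j < i \<and> i < cover j}" by auto
  then have "card {j. j < i \<and> cover j \<le> i} = i - card {j. j < i \<and> i < cover j}"
    using card_Diff_subset[of "{j. j < i \<and> i < cover j}" "{..<i}"] by auto
  then show ?thesis using bij_betw_same_card[OF bij_height[OF assms]] low_le[OF assms] by (simp add: height_def)
qed

lemma start_le_iff:
  assumes "i < j" "j < n" shows "start j \<le> i \<longleftrightarrow> low i = low j"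
proof
  assume "start j \<le> i"
  have "low (start j) = low j" unfolding start_def by (rule LeastI) simp
  then show "low i = low j" using low_mono[of "start j" i] low_mono[of i j] \<open>start j \<le> i\<close> assms by simp
next
  assume "low i = low j" then show "start j \<le> i" unfolding start_def by (rule Least_le)
qed

lemma start_le: "start j \<le> j"
  unfolding start_def by (rule Least_le) simp

text \<open>\<open>E\<close> is the last level at which \<open>g\<close> attains the minimum
  \<open>low i\<close>. The later levels counted here have the same \<open>low\<close> as
  \<open>i\<close> and are exactly those up to \<open>E\<close>, so the argument of \<open>g\<close>
  equals \<open>E\<close>. They will be the levels whose sensors are counted.\<close>

lemma g_card:
  assumes i: "i < n"
  shows "g (i + card {j. i < j \<and> j < n \<and> start j \<le> i}) = low i"
proof -
  define E where "E = Max {k \<in> {i..<n}. g k = low i}"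
  have "low i \<in> g ` {i..<n}" unfolding low_def using i by (intro Min_in) auto
  then have ne: "{k \<in> {i..<n}. g k = low i} \<noteq> {}" by auto
  then have E: "E \<in> {k \<in> {i..<n}. g k = low i}" unfolding E_def by (intro Max_in) auto
  have "{j. i < j \<and> j < n \<and> start j \<le> i} = {i<..E}"
  proof (intro set_eqI iffI)
    fix j assume "j \<in> {j. i < j \<and> j < n \<and> start j \<le> i}"
    then have j: "i < j" "j < n" "low i = low j" using start_le_iff by auto
    have "low j \<in> g ` {j..<n}" unfolding low_def using j by (intro Min_in) auto
    then obtain k where "j \<le> k" "k < n" "g k = low i" using j by auto
    then have "k \<le> E" unfolding E_def using j by (intro Max_ge) auto
    then show "j \<in> {i<..E}" using j \<open>j \<le> k\<close> by auto
  next
    fix j assume j: "j \<in> {i<..E}"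
    then have "low j \<le> low i" using low_le_g[of j E] E by auto
    then have "low i = low j" using low_mono[of i j] j E by auto
    then show "j \<in> {j. i < j \<and> j < n \<and> start j \<le> i}" using j E start_le_iff by auto
  qed
  then show ?thesis using E by auto
qed

end

section \<open>Coding processes by natural numbers\<close>

lemma sum_sum_list_delta:
  assumes "finite T" "\<And>w t. (w, t) \<in> set xs \<Longrightarrow> f t \<in> T"
  shows "(\<Sum>y\<in>T. (\<Sum>(w, t)\<leftarrow>xs. if f t = y then w else (0::real)) * v y) = (\<Sum>(w, t)\<leftarrow>xs. w * v (f t))"
  using assms(2)
proof (induction xs)
  case (Cons x xs)
  obtain w t where x: "x = (w, t)" by fastforce
  have "f t \<in> T" using Cons.prems[of w t] x by simp
  have "(\<Sum>y\<in>T. (if f t = y then w else 0) * v y) = (\<Sum>y\<in>T. if y = f t then w * v (f t) else 0)"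
    by (intro sum.cong) auto
  then have "(\<Sum>y\<in>T. (if f t = y then w else 0) * v y) = w * v (f t)"
    using assms(1) \<open>f t \<in> T\<close> by simp
  moreover have "(\<Sum>y\<in>T. (\<Sum>(w, t)\<leftarrow>xs. if f t = y then w else 0) * v y) = (\<Sum>(w, t)\<leftarrow>xs. w * v (f t))"
    by (rule Cons.IH, rule Cons.prems) (rule list.set_intros(2))
  ultimately show ?case using x by (simp add: distrib_right sum.distrib)
qed simp

text \<open>\<open>dl a\<close> lists the successors of \<open>a\<close> with their probabilities, and \<open>P0\<close> witnesses that the sink is
  reachable from everywhere.\<close>

locale coded_mdp =
  fixes S :: "'s set" and av :: "'s \<Rightarrow> 'a set" and rw :: "'a \<Rightarrow> real"
    and dl :: "'a \<Rightarrow> (real \<times> 's) list"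
    and eS :: "'s \<Rightarrow> nat" and eA :: "'a \<Rightarrow> nat" and snk :: 's
    and P0 :: "'s \<Rightarrow> 'a"
  assumes finS: "finite S" and finA: "\<And>s. s \<in> S \<Longrightarrow> finite (av s)"
    and av_disj: "\<And>s t. s \<in> S \<Longrightarrow> t \<in> S \<Longrightarrow> s \<noteq> t \<Longrightarrow> av s \<inter> av t = {}"
    and inj_eS: "inj_on eS S" and inj_eA: "inj_on eA (\<Union>s\<in>S. av s)"
    and dl_ok: "\<And>s a w t. s \<in> S \<Longrightarrow> a \<in> av s \<Longrightarrow> (w, t) \<in> set (dl a) \<Longrightarrow> t \<in> S \<and> 0 \<le> w"
    and dl_sum: "\<And>s a. s \<in> S \<Longrightarrow> a \<in> av s \<Longrightarrow> (\<Sum>(w, t)\<leftarrow>dl a. w) = 1"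
    and snk: "snk \<in> S" "\<exists>a. av snk = {a} \<and> rw a = 0 \<and> dl a = [(1, snk)]"
    and P0: "\<And>s. s \<in> S \<Longrightarrow> P0 s \<in> av s"
      "\<And>s. s \<in> S \<Longrightarrow> (s, snk) \<in> {(s, t). s \<in> S \<and> (\<exists>w>0. (w, t) \<in> set (dl (P0 s)))}\<^sup>*"
begin

definition A :: "'a set" where "A = (\<Union>s\<in>S. av s)"

definition M :: mdp where
  "M = \<lparr>St = eS ` S, Act = eA ` A, rew = (\<lambda>x. rw (inv_into A eA x)),
     prob = (\<lambda>x y. \<Sum>(w, t)\<leftarrow>dl (inv_into A eA x). if eS t = y then w else 0),
     Av = (\<lambda>x. eA ` av (inv_into S eS x)), sink = eS snk\<rparr>"

definition rel :: "('s \<Rightarrow> 'a) \<Rightarrow> ('s \<times> 's) set" where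
  "rel P = {(s, t). s \<in> S \<and> (\<exists>w>0. (w, t) \<in> set (dl (P s)))}"

definition good_pol :: "('s \<Rightarrow> 'a) \<Rightarrow> bool" where
  "good_pol P \<longleftrightarrow> (\<forall>s\<in>S. P s \<in> av s) \<and> (\<forall>s\<in>S. (s, snk) \<in> (rel P)\<^sup>*)"

text \<open>The default 0 off the coded states makes \<open>switch_M\<close> an equality of
  functions.\<close>

definition pol :: "('s \<Rightarrow> 'a) \<Rightarrow> nat \<Rightarrow> nat" where
  "pol P x = (if x \<in> eS ` S then eA (P (inv_into S eS x)) else 0)"

definition ev :: "('s \<Rightarrow> real) \<Rightarrow> 'a \<Rightarrow> real" where
  "ev V a = rw a + (\<Sum>(w, t)\<leftarrow>dl a. w * V t)"

definition lift :: "('s \<Rightarrow> real) \<Rightarrow> nat \<Rightarrow> real" where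
  "lift V x = (if x \<in> eS ` S then V (inv_into S eS x) else 0)"

definition solves :: "('s \<Rightarrow> 'a) \<Rightarrow> ('s \<Rightarrow> real) \<Rightarrow> bool" where
  "solves P V \<longleftrightarrow> V snk = 0 \<and> (\<forall>s\<in>S. V s = ev V (P s))"

lemma M_simps [simp]:
  "St M = eS ` S" "Act M = eA ` A" "sink M = eS snk"
  "a \<in> A \<Longrightarrow> rew M (eA a) = rw a"
  "a \<in> A \<Longrightarrow> prob M (eA a) y = (\<Sum>(w, t)\<leftarrow>dl a. if eS t = y then w else 0)"
  "s \<in> S \<Longrightarrow> Av M (eS s) = eA ` av s"
  using inj_eS inj_eA by (auto simp: M_def A_def)

lemma coded_simps [simp]:
  "s \<in> S \<Longrightarrow> pol P (eS s) = eA (P s)" "s \<in> S \<Longrightarrow> lift V (eS s) = V s"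
  using inj_eS by (auto simp: pol_def lift_def)

lemma AI: "s \<in> S \<Longrightarrow> a \<in> av s \<Longrightarrow> a \<in> A" by (auto simp: A_def)

lemma eS_eq_iff: "s \<in> S \<Longrightarrow> t \<in> S \<Longrightarrow> eS s = eS t \<longleftrightarrow> s = t"
  using inj_eS by (auto simp: inj_on_def)

lemma prob_sum:
  assumes "a \<in> A"
  shows "(\<Sum>y \<in> eS ` S. prob M (eA a) y * v y) = (\<Sum>(w, t)\<leftarrow>dl a. w * v (eS t))"
proof -
  have "t \<in> S" if "(w, t) \<in> set (dl a)" for w t using that assms dl_ok by (auto simp: A_def)
  then show ?thesis using assms finS by (simp add: sum_sum_list_delta)
qed

lemma lift_sum:
  assumes "a \<in> A" shows "rew M (eA a) + (\<Sum>y \<in> eS ` S. prob M (eA a) y * lift V y) = ev V a"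
proof -
  have "t \<in> S" if "(w, t) \<in> set (dl a)" for w t using that assms dl_ok by (auto simp: A_def)
  then have "(\<Sum>(w, t)\<leftarrow>dl a. w * lift V (eS t)) = (\<Sum>(w, t)\<leftarrow>dl a. w * V t)"
    by (intro arg_cong[of _ _ sum_list] map_cong) auto
  then show ?thesis unfolding prob_sum[OF assms] using assms by (simp add: ev_def)
qed

lemma prob_pos:
  assumes "a \<in> A" "(w, t) \<in> set (dl a)" "w > 0"
  shows "prob M (eA a) (eS t) > 0"
proof -
  have "0 \<le> w" if "(w, t) \<in> set (dl a)" for w t using that assms(1) dl_ok by (auto simp: A_def)
  moreover have "w \<in> set (map (\<lambda>(w, t'). if eS t' = eS t then w else 0) (dl a))"
    using assms by force
  ultimately have "w \<le> (\<Sum>(w, t')\<leftarrow>dl a. if eS t' = eS t then w else 0)"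
    by (intro member_le_sum_list) auto
  then show ?thesis using assms by simp
qed

lemma rel_edges:
  assumes P: "\<And>s. s \<in> S \<Longrightarrow> P s \<in> av s" and st: "(s, t) \<in> (rel P)\<^sup>*"
  shows "(eS s, eS t) \<in> (pol_edges M (pol P))\<^sup>*"
  using st
proof (induction rule: rtrancl_induct)
  case (step y z)
  then obtain w where "y \<in> S" "w > 0" "(w, z) \<in> set (dl (P y))" by (auto simp: rel_def)
  then have "(eS y, eS z) \<in> pol_edges M (pol P)"
    using prob_pos[OF AI[OF _ P]] by (auto simp: pol_edges_def)
  then show ?case using step by simp
qed simp

lemma policy_pol: "(\<And>s. s \<in> S \<Longrightarrow> P s \<in> av s) \<Longrightarrow> policy M (pol P)"
  by (auto simp: policy_def)

lemma proper_pol: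
  assumes "good_pol P" shows "proper M (pol P)"
  unfolding proper_def using assms by (auto simp: good_pol_def intro!: policy_pol rel_edges)

lemma is_mdp_M: "is_mdp M"
  unfolding is_mdp_def
proof (intro conjI ballI)
  show "finite (St M)" "finite (Act M)" using finS finA by (auto simp: A_def)
  fix s assume s: "s \<in> St M"
  then show "Av M s \<noteq> {}" using P0(1) by fastforce
  show "(s, sink M) \<in> (edges M)\<^sup>*"
  proof -
    obtain s' where s': "s = eS s'" "s' \<in> S" using s by auto
    have "(eS s', eS snk) \<in> (pol_edges M (pol P0))\<^sup>*"
      using rel_edges[of P0 s' snk] P0 s' by (simp add: rel_def)
    moreover have "pol_edges M (pol P0) \<subseteq> edges M"
      using P0(1) by (auto simp: pol_edges_def edges_def)
    ultimately show ?thesis using s' rtrancl_mono by auto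
  qed
  fix t assume t: "t \<in> St M"
  show "s \<noteq> t \<longrightarrow> Av M s \<inter> Av M t = {}"
  proof
    assume "s \<noteq> t"
    then obtain s' t' where *: "s' \<in> S" "t' \<in> S" "s' \<noteq> t'" "s = eS s'" "t = eS t'" using s t by auto
    have "eA ` av s' \<inter> eA ` av t' = eA ` (av s' \<inter> av t')"
      by (rule inj_on_image_Int[OF inj_eA, symmetric]) (use * in auto)
    then show "Av M s \<inter> Av M t = {}" using * av_disj by auto
  qed
next
  show "Act M = (\<Union>s\<in>St M. Av M s)" by (auto simp: A_def)
  show "sink M \<in> St M" using snk by simp
  obtain a where a: "av snk = {a}" "rw a = 0" "dl a = [(1, snk)]" using snk by blast
  then have "a \<in> A" using snk by (auto simp: A_def)
  then show "\<exists>a0. Av M (sink M) = {a0} \<and> rew M a0 = 0 \<and> prob M a0 (sink M) = 1"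
    using a snk by (intro exI[of _ "eA a"]) simp
next
  fix x assume "x \<in> Act M"
  then obtain a where a: "a \<in> A" "x = eA a" by auto
  then obtain s where s: "s \<in> S" "a \<in> av s" by (auto simp: A_def)
  show "\<forall>t. 0 \<le> prob M x t"
    using a dl_ok[OF s] by (auto intro!: sum_list_nonneg split: if_splits)
  show "\<forall>t. t \<notin> St M \<longrightarrow> prob M x t = 0"
  proof (intro allI impI)
    fix y assume y: "y \<notin> St M"
    have "(\<Sum>(w, t)\<leftarrow>dl a. if eS t = y then w else 0) = (\<Sum>x\<leftarrow>dl a. 0)"
      using dl_ok[OF s] y by (intro arg_cong[of _ _ sum_list] map_cong) auto
    then show "prob M x y = 0" using a by simp
  qed
  show "(\<Sum>t\<in>St M. prob M x t) = 1"
    using prob_sum[OF a(1), of "\<lambda>_. 1"] dl_sum[OF s] a by simp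
qed

lemma bellman_lift: "solves P V \<Longrightarrow> good_pol P \<Longrightarrow> bellman M (pol P) (lift V)"
  unfolding bellman_def
proof (intro conjI ballI allI impI)
  assume *: "solves P V" "good_pol P"
  show "lift V (sink M) = 0" using * snk by (simp add: solves_def)
  fix x assume "x \<in> St M"
  then obtain s where s: "x = eS s" "s \<in> S" by auto
  then have "P s \<in> A" "V s = ev V (P s)" using * AI by (auto simp: solves_def good_pol_def)
  then show "lift V x = rew M (pol P x) + (\<Sum>t\<in>St M. prob M (pol P x) t * lift V t)"
    using lift_sum[of "P s" V] s by simp
next
  fix x assume "x \<notin> St M" then show "lift V x = 0" by (simp add: lift_def)
qed

lemma val_pol: "solves P V \<Longrightarrow> good_pol P \<Longrightarrow> val M (pol P) = lift V"
  by (intro val_eqI is_mdp_M proper_pol bellman_lift)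

lemma st_of_M: "s \<in> S \<Longrightarrow> a \<in> av s \<Longrightarrow> st_of M (eA a) = eS s"
  by (intro st_of_eq is_mdp_M) auto

lemma rc_M:
  assumes "solves P V" "good_pol P" "s \<in> S" "a \<in> av s"
  shows "rc M (pol P) (eA a) = ev V a - V s"
  using lift_sum[OF AI[OF assms(3,4)], of V] assms by (simp add: rc_def val_pol st_of_M)

lemma improving_M:
  assumes "solves P V" "good_pol P"
  shows "improving M (pol P) = eA ` {a. \<exists>s\<in>S. a \<in> av s \<and> V s < ev V a}"
proof (intro set_eqI iffI)
  fix x assume "x \<in> improving M (pol P)"
  then obtain s a where "s \<in> S" "a \<in> av s" "x = eA a" "rc M (pol P) x > 0"
    by (auto simp: improving_def A_def)
  then show "x \<in> eA ` {a. \<exists>s\<in>S. a \<in> av s \<and> V s < ev V a}" using rc_M[OF assms] by auto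
next
  fix x assume "x \<in> eA ` {a. \<exists>s\<in>S. a \<in> av s \<and> V s < ev V a}"
  then show "x \<in> improving M (pol P)" using rc_M[OF assms] AI by (auto simp: improving_def)
qed

lemma switch_M:
  assumes "s \<in> S" "a \<in> av s"
  shows "switch M (pol P) (eA a) = pol (P(s := a))"
  unfolding switch_def st_of_M[OF assms] using assms inj_eS
  by (auto simp: pol_def fun_eq_iff eS_eq_iff)

lemma li_gain:
  assumes "solves P V" "good_pol P" "s \<in> S" "a \<in> av s"
    and "solves (P(s := a)) V'" "good_pol (P(s := a))" "V s \<le> V' s"
  defines "G \<equiv> (\<Sum>t \<in> St M. val M (switch M (pol P) (eA a)) t) - (\<Sum>t \<in> St M. val M (pol P) t)"
  shows "V' s - V s \<le> G" "G \<le> real (card S) * (V' s - V s)"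
proof -
  have sw: "pol (P(s := a)) = (pol P)(eS s := eA a)"
    using switch_M[OF assms(3,4), of P] st_of_M[OF assms(3,4)] by (simp add: switch_def)
  have G: "G = (\<Sum>t \<in> St M. lift V' t) - (\<Sum>t \<in> St M. lift V t)"
    using assms by (simp add: G_def switch_M val_pol)
  note * = switch_gain[OF is_mdp_M, of "pol P" "eS s" "eA a" "lift V" "lift V'", folded sw,
      OF proper_pol[OF assms(6)] bellman_lift[OF assms(1,2)] bellman_lift[OF assms(5,6)]]
  show "V' s - V s \<le> G" "G \<le> real (card S) * (V' s - V s)"
    using *(1) *(2) assms(3,7) unfolding G by (simp_all add: card_image inj_eS)
qed

lemma optimal_pol:
  assumes "solves P V" "good_pol P" "\<And>s a. s \<in> S \<Longrightarrow> a \<in> av s \<Longrightarrow> ev V a \<le> V s"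
    and "\<And>s. s \<in> S \<Longrightarrow> 0 \<le> V s"
  shows "weak_unichain_mdp M"
proof -
  have "improving M (pol P) = {}" using assms(3) improving_M[OF assms(1,2)] by (auto simp: not_less)
  then have "optimal_policy M (pol P)"
    using assms by (intro optimal_policyI is_mdp_M proper_pol) (auto simp: val_pol)
  then show ?thesis using is_mdp_M by (auto simp: weak_unichain_mdp_def)
qed

lemma finite_A: "finite A" using finS finA by (simp add: A_def)

lemma num_trans_eq:
  "{(x, y). x \<in> Act M \<and> y \<in> St M \<and> prob M x y \<noteq> 0} \<subseteq> (\<lambda>(a, t). (eA a, eS t)) ` (SIGMA a:A. snd ` set (dl a))"
proof clarify
  fix x y assume *: "x \<in> Act M" "y \<in> St M" "prob M x y \<noteq> 0"
  then obtain a where a: "a \<in> A" "x = eA a" by auto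
  have "\<exists>t \<in> snd ` set (dl a). eS t = y"
  proof (rule ccontr)
    assume "\<not> ?thesis"
    then have "(\<Sum>(w, t)\<leftarrow>dl a. if eS t = y then w else 0) = (\<Sum>x\<leftarrow>dl a. 0)"
      by (intro arg_cong[of _ _ sum_list] map_cong) force+
    then show False using * a by simp
  qed
  then show "(x, y) \<in> (\<lambda>(a, t). (eA a, eS t)) ` (SIGMA a:A. snd ` set (dl a))" using a by force
qed

lemma num_trans_le: "num_trans M \<le> (\<Sum>a\<in>A. length (dl a))"
proof -
  have "num_trans M \<le> card (SIGMA a:A. snd ` set (dl a))"
    unfolding num_trans_def using num_trans_eq finite_A by (intro surj_card_le) auto
  also have "\<dots> = (\<Sum>a\<in>A. card (snd ` set (dl a)))" using finite_A by simp
  also have "\<dots> \<le> (\<Sum>a\<in>A. length (dl a))"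
    by (intro sum_mono) (metis card_image_le card_length finite_set le_trans)
  finally show ?thesis .
qed

text \<open>Probabilities of an action sum to 1, so each action contributes a non-zero one.\<close>

lemma card_A_le: "card A \<le> num_trans M"
proof -
  let ?R = "{(x, y). x \<in> Act M \<and> y \<in> St M \<and> prob M x y \<noteq> 0}"
  have "finite ?R" by (rule finite_subset[OF num_trans_eq]) (use finite_A in auto)
  have "Act M \<subseteq> fst ` ?R"
  proof
    fix x assume x: "x \<in> Act M"
    then have "(\<Sum>y\<in>St M. prob M x y) \<noteq> 0" using mdp_prob(3)[OF is_mdp_M] by simp
    then obtain y where "y \<in> St M" "prob M x y \<noteq> 0" by (meson sum.neutral)
    then show "x \<in> fst ` ?R" using x by force
  qed
  then have "card (Act M) \<le> card ?R" by (rule surj_card_le[OF \<open>finite ?R\<close>])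
  moreover have "card (Act M) = card A" using inj_eA by (simp add: A_def card_image)
  ultimately show ?thesis by (simp add: num_trans_def)
qed

end

section \<open>The counter\<close>

text \<open>\<open>Pt i True\<close> and \<open>Pt i False\<close> are the two ports of level \<open>i\<close>, \<open>B i k\<close> is the path from \<open>C i\<close> to
  \<open>Pt i k\<close>, which is open under \<open>B1 i k\<close> and leads back to \<open>C i\<close> under \<open>B0 i k\<close>. The sensor \<open>Sn j\<close> is
  visited by no other state; its switch \<open>S1 j\<close> only serves to be counted.\<close>

datatype state = Snk | C nat | B nat bool | Pt nat bool | Sn nat
datatype action = Stay | CA nat bool | B0 nat bool | B1 nat bool | PA nat bool | S0 nat | S1 nat

fun state_code :: "state \<Rightarrow> nat" where
  "state_code Snk = 0"
| "state_code (C i) = 6 * i + 1"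
| "state_code (B i k) = 6 * i + (if k then 2 else 3)"
| "state_code (Pt i k) = 6 * i + (if k then 4 else 5)"
| "state_code (Sn i) = 6 * i + 6"

lemma inj_state_code: "inj state_code"
proof (rule injI)
  fix s t assume "state_code s = state_code t"
  then show "s = t" by (cases s; cases t) (auto split: if_splits; presburger)+
qed

context counter
begin

text \<open>\<open>gap i\<close> is the difference between the values of the two ports of level \<open>i\<close>. The exponents place \<open>gam j\<close>
  between \<open>gap (cover j - 1)\<close> and \<open>gap (cover j)\<close>, with later levels ahead of earlier ones in each such interval.
  All gains are powers of \<open>eps\<close> up to factors that are small compared with \<open>1 / eps\<close>.\<close>

definition L :: nat where "L = n + 2"
definition eps :: real where "eps = 1 / (100 * (real n + 1))"
definition gap_exp :: "nat \<Rightarrow> nat" where "gap_exp i = L * i"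
definition gam_exp :: "nat \<Rightarrow> nat" where "gam_exp i = L * cover i - 1 - i"
definition tau_exp :: "nat \<Rightarrow> nat" where "tau_exp i = L * (n + 1) + i"
definition gap :: "nat \<Rightarrow> real" where "gap i = eps ^ gap_exp i"
definition gam :: "nat \<Rightarrow> real" where "gam i = eps ^ gam_exp i"
text \<open>The probability of leaving an open path for its port, chosen such that
  \<open>eta i * gap i = gam i\<close>: a port difference of \<open>gap i\<close> is felt at the
  path only as \<open>gam i\<close>.\<close>

definition eta :: "nat \<Rightarrow> real" where "eta i = eps ^ (gam_exp i - gap_exp i)"
definition tau :: "nat \<Rightarrow> real" where "tau i = eps ^ tau_exp i"
text \<open>The factor 2 compensates for comparing \<open>C i\<close> with the average of two ports:
  these differ by half of \<open>gap i\<close>, and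
  \<open>scale * gap i / 2 = gap (Suc i)\<close>.\<close>

definition scale :: real where "scale = 2 * eps ^ L"
text \<open>Dividing by \<open>gam\<close> brings the signals of the levels \<open>start j\<close>
  and \<open>j\<close> to the common unit \<open>tau j\<close>, with weights 3 and 9.\<close>

definition wA :: "nat \<Rightarrow> real" where "wA j = 3 * tau j / gam (start j)"
definition wZ :: "nat \<Rightarrow> real" where "wZ j = 9 * tau j / gam j"

section \<open>Order of the exponents and sizes of the parameters\<close>

lemma eps: "0 < eps" "eps \<le> 1 / 100" "eps < 1" "eps * (6 * real n + 1) \<le> 6 / 100"
  by (auto simp: eps_def field_simps)

lemma pos: "0 < gap i" "0 < gam i" "0 < eta i" "0 < tau i" "0 < scale" "0 < wA i" "0 < wZ i"
  using eps by (auto simp: gap_def gam_def eta_def tau_def scale_def wA_def wZ_def)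

lemma L_cover: "j < n \<Longrightarrow> L * j + L \<le> L * cover j \<and> L * cover j \<le> L * n"
  using cover_props(1)[of j] cover_le_n[of j] mult_le_mono2[of "Suc j" "cover j" L] by simp

lemma gap_exp_less_gam_exp: "j < n \<Longrightarrow> gap_exp j < gam_exp j"
  using L_cover[of j] L_def unfolding gap_exp_def gam_exp_def by linarith

lemma gam_exp_less_tau_exp: "i < n \<Longrightarrow> gam_exp i < tau_exp j"
  using L_cover[of i] L_def unfolding gam_exp_def tau_exp_def distrib_left by linarith

lemma gam_exp_less_gap_exp:
  assumes "j < i" "i < n" "cover j \<le> i" shows "gam_exp j < gap_exp i"
proof -
  have "L * cover j \<le> L * i" using assms by simp
  then show ?thesis using L_cover[of j] assms(1,2) L_def unfolding gam_exp_def gap_exp_def by linarith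
qed

text \<open>Nesting gives \<open>cover i \<le> cover j\<close>; in case of equality the subtracted
  \<open>i\<close> in \<open>gam_exp\<close> puts the later level ahead.\<close>

lemma gam_exp_less_gam_exp:
  assumes "j < i" "i < n" "i < cover j" shows "gam_exp i < gam_exp j"
proof -
  have "L * cover i \<le> L * cover j" using cover_nested[OF assms(1,3,2)] by simp
  then show ?thesis using L_cover[of i] assms(1,2) L_def unfolding gam_exp_def by linarith
qed

text \<open>With \<open>card_cover_le\<close>, exactly \<open>low i\<close> of the levels below
  \<open>i\<close> beat level \<open>i\<close>.\<close>

lemma gam_exp_less_iff:
  assumes "j < i" "i < n" shows "gam_exp j < gam_exp i \<longleftrightarrow> cover j \<le> i"
  using gam_exp_less_gam_exp[OF assms] gam_exp_less_gap_exp[OF assms] gap_exp_less_gam_exp[OF assms(2)] by linarith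

lemma inj_gam_exp: "inj_on gam_exp {..<n}"
proof -
  have "gam_exp i \<noteq> gam_exp j" if "j < i" "i < n" for i j
    using gam_exp_less_gam_exp[OF that] gam_exp_less_gap_exp[OF that] gap_exp_less_gam_exp[OF that(2)] by linarith
  then show ?thesis by (auto simp: inj_on_def) (metis linorder_neqE_nat)
qed

lemma eps_power_less: "i < j \<Longrightarrow> eps ^ j \<le> eps * eps ^ i"
  using eps power_decreasing[of "Suc i" j eps] by simp

lemma gam_eq: "i < n \<Longrightarrow> gam i = eta i * gap i"
  using gap_exp_less_gam_exp[of i] by (simp add: gam_def eta_def gap_def flip: power_add)

lemma eta_small: "i < n \<Longrightarrow> eta i \<le> eps"
  using gap_exp_less_gam_exp[of i] eps power_decreasing[of 1 "gam_exp i - gap_exp i" eps] by (simp add: eta_def)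

lemma scale_small: "scale \<le> 1 / 50"
proof -
  have "eps ^ L \<le> eps ^ 1" using eps by (intro power_decreasing) (auto simp: L_def)
  then show ?thesis using eps by (simp add: scale_def)
qed

lemma gap_Suc: "2 * gap (Suc i) = scale * gap i"
  by (simp add: gap_def scale_def gap_exp_def power_add)

lemma gam_le_gap: "i < n \<Longrightarrow> gam i \<le> gap i"
  using eta_small[of i] pos(1,3)[of i] eps gam_eq[of i] by (simp add: mult_left_le_one_le)

text \<open>Keeps the remaining probability \<open>1 - 2 * wA j - 2 * wZ j\<close> of the sensor
  actions positive.\<close>

lemma w_small:
  assumes "j < n" shows "wA j \<le> 3 / 100" "wZ j \<le> 9 / 100"
proof -
  have "tau j \<le> eps * gam i" if "i < n" for i
    using eps_power_less[OF gam_exp_less_tau_exp[OF that]] by (simp add: tau_def gam_def)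
  moreover have "eps * gam i \<le> gam i / 100" for i using eps(2) pos(2)[of i] mult_right_mono[of eps "1/100" "gam i"] by simp
  ultimately have *: "tau j \<le> gam i / 100" if "i < n" for i using that order_trans by blast
  have "start j < n" using start_le[of j] assms by simp
  then show "wA j \<le> 3 / 100" "wZ j \<le> 9 / 100"
    using *[of j] *[of "start j"] pos(2) assms by (auto simp: wA_def wZ_def field_simps)
qed

text \<open>The \<open>True\<close> port of the next level is fed by \<open>C i\<close>, the
  \<open>False\<close> port by the average of both ports of level \<open>i\<close>, so moving
  \<open>C i\<close> reverses their order. \<open>S0 j\<close> combines the actual paths of level
  \<open>start j\<close> with both paths of level \<open>j\<close> as if they were open, and
  \<open>S1 j\<close> exchanges these roles; their difference compares what opening would gain at
  the two levels.\<close>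

fun dl :: "action \<Rightarrow> (real \<times> state) list" where
  "dl Stay = [(1, Snk)]"
| "dl (CA i k) = [(1, B i k)]"
| "dl (B0 i k) = [(1, C i)]"
| "dl (B1 i k) = [(eta i, Pt i k), (1 - eta i, C i)]"
| "dl (PA 0 k) = [(1, Snk)]"
| "dl (PA (Suc i) k) = (if k then [(scale, C i), (1 - scale, Snk)]
     else [(scale / 2, Pt i True), (scale / 2, Pt i False), (1 - scale, Snk)])"
| "dl (S0 j) = [(wA j, B (start j) True), (wA j, B (start j) False), (2 * wZ j * (1 - eta j), C j),
     (wZ j * eta j, Pt j True), (wZ j * eta j, Pt j False), (1 - 2 * wA j - 2 * wZ j, Snk)]"
| "dl (S1 j) = [(2 * wA j * (1 - eta (start j)), C (start j)), (wA j * eta (start j), Pt (start j) True),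
     (wA j * eta (start j), Pt (start j) False), (wZ j, B j True), (wZ j, B j False),
     (1 - 2 * wA j - 2 * wZ j, Snk)]"

text \<open>The loss on closed paths leads to the gains 4/3, 1 and 2/3 of \<open>gam i\<close> in
  phases 3, 2 and 1. The reward of \<open>S0 j\<close> is the threshold that the sensor signal has
  to exceed.\<close>

fun rw :: "action \<Rightarrow> real" where
  "rw (B0 i k) = - (gam i / 3)"
| "rw (PA 0 k) = (if k then 2 else 1)"
| "rw (S0 j) = 5 * tau j"
| "rw _ = 0"

fun av :: "state \<Rightarrow> action set" where
  "av Snk = {Stay}"
| "av (C i) = {CA i True, CA i False}"
| "av (B i k) = {B0 i k, B1 i k}"
| "av (Pt i k) = {PA i k}"
| "av (Sn i) = {S0 i, S1 i}"

text \<open>The key is the exponent of the gain, so that smaller indices have larger gains and Bland's ranking agrees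
  with the other two. (For port actions the key has no such meaning.)\<close>

fun key :: "action \<Rightarrow> nat" where
  "key Stay = 0"
| "key (CA i k) = gam_exp i"
| "key (B0 i k) = gam_exp i"
| "key (B1 i k) = gam_exp i"
| "key (PA i k) = (if k then i else Suc i)"
| "key (S0 j) = tau_exp j"
| "key (S1 j) = tau_exp j"

text \<open>Separates actions with a common key. \<open>Stay\<close> and \<open>PA i False\<close>
  share kind 0 but differ in the key, which is \<open>Suc i\<close> for the latter; kinds 1 and 2
  recur for sensors, whose keys are no \<open>gam_exp\<close> of a level.\<close>

fun kind :: "action \<Rightarrow> nat" where
  "kind Stay = 0"
| "kind (CA i k) = (if k then 1 else 2)"
| "kind (B0 i k) = (if k then 3 else 4)"
| "kind (B1 i k) = (if k then 5 else 6)"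
| "kind (PA i k) = (if k then 7 else 0)"
| "kind (S0 j) = 1"
| "kind (S1 j) = 2"

definition action_code :: "action \<Rightarrow> nat" where "action_code a = 8 * key a + kind a"

fun level_ok :: "state \<Rightarrow> bool" where
  "level_ok Snk = True"
| "level_ok (C i) = (i < n)"
| "level_ok (B i k) = (i < n)"
| "level_ok (Pt i k) = (i < n)"
| "level_ok (Sn i) = (i < n)"

definition SS :: "state set" where "SS = {s. level_ok s}"

lemma SS_simps [simp]:
  "Snk \<in> SS" "C i \<in> SS \<longleftrightarrow> i < n" "B i k \<in> SS \<longleftrightarrow> i < n" "Pt i k \<in> SS \<longleftrightarrow> i < n" "Sn i \<in> SS \<longleftrightarrow> i < n"
  by (auto simp: SS_def)

lemma SS_code: "state_code ` SS \<subseteq> {..< 6 * n + 1}"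
  by (auto simp: SS_def elim!: level_ok.elims)

lemma finite_SS: "finite SS" and card_SS: "card SS \<le> 6 * n + 1"
proof -
  have inj: "inj_on state_code SS" using inj_state_code by (rule inj_on_subset) simp
  show "finite SS" using finite_subset[OF SS_code] inj finite_imageD by blast
  show "card SS \<le> 6 * n + 1" using card_mono[OF _ SS_code] card_image[OF inj] by simp
qed

lemma kind_less: "kind a < 8" by (cases a) auto

lemma action_code_eqD: "action_code a = action_code b \<Longrightarrow> key a = key b \<and> kind a = kind b"
  using kind_less[of a] kind_less[of b] by (simp add: action_code_def) presburger

lemma gam_exp_eq_iff: "i < n \<Longrightarrow> j < n \<Longrightarrow> gam_exp i = gam_exp j \<longleftrightarrow> i = j"
  using inj_gam_exp by (auto simp: inj_on_def)

lemma tau_exp_eq_iff [simp]: "tau_exp i = tau_exp j \<longleftrightarrow> i = j" by (simp add: tau_exp_def)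

lemma inj_action_code: "inj_on action_code (\<Union>s\<in>SS. av s)"
proof (rule inj_onI)
  fix a b assume a: "a \<in> (\<Union>s\<in>SS. av s)" and b: "b \<in> (\<Union>s\<in>SS. av s)" and eq: "action_code a = action_code b"
  have tn: "gam_exp i \<noteq> tau_exp j" "tau_exp j \<noteq> gam_exp i" if "i < n" for i j using gam_exp_less_tau_exp[OF that, of j] by auto
  obtain s t where s: "s \<in> SS" "a \<in> av s" and t: "t \<in> SS" "b \<in> av t" using a b by auto
  show "a = b"
    using action_code_eqD[OF eq] s t
    by (cases s; cases t) (auto simp: gam_exp_eq_iff tn split: if_splits)
qed

text \<open>The phase \<open>ph i\<close> counts the switches that level \<open>i\<close> has yet to make before it rests: 3 if the path to the
  better port has to be opened, 2 if \<open>C i\<close> has to move, 1 if the old path has to be closed. Up to the sensors, it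
  determines the policy: \<open>better ph i\<close> is the better port of level \<open>i\<close>, \<open>aligned\<close> says that \<open>C i\<close> uses
  it, and \<open>other_set\<close> that the path not used by \<open>C i\<close> is open.\<close>

definition aligned :: "(nat \<Rightarrow> nat) \<Rightarrow> nat \<Rightarrow> bool" where "aligned ph i \<longleftrightarrow> ph i \<le> 1"
definition other_set :: "(nat \<Rightarrow> nat) \<Rightarrow> nat \<Rightarrow> bool" where "other_set ph i \<longleftrightarrow> ph i = 1 \<or> ph i = 2"
fun better :: "(nat \<Rightarrow> nat) \<Rightarrow> nat \<Rightarrow> bool" where "better ph 0 = True" | "better ph (Suc i) = aligned ph i"
definition choice :: "(nat \<Rightarrow> nat) \<Rightarrow> nat \<Rightarrow> bool" where "choice ph i \<longleftrightarrow> (better ph i = aligned ph i)"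

fun strategy :: "(nat \<Rightarrow> nat) \<Rightarrow> (nat \<Rightarrow> bool) \<Rightarrow> state \<Rightarrow> action" where
  "strategy ph e Snk = Stay"
| "strategy ph e (C i) = CA i (choice ph i)"
| "strategy ph e (B i k) = (if k = choice ph i \<or> other_set ph i then B1 i k else B0 i k)"
| "strategy ph e (Pt i k) = PA i k"
| "strategy ph e (Sn j) = (if e j then S1 j else S0 j)"

lemma strategy_av: "strategy ph e s \<in> av s" by (cases s) auto

text \<open>In every phase the path used by \<open>C i\<close> is open, so \<open>C i\<close> gets
  to a port; ports and sensors have a direct transition to the sink, and closed paths lead back to
  \<open>C i\<close>.\<close>

lemma strategy_reach:
  assumes "s \<in> SS"
  shows "(s, Snk) \<in> {(s, t). s \<in> SS \<and> (\<exists>w>0. (w, t) \<in> set (dl (strategy ph e s)))}\<^sup>*" (is "_ \<in> ?R\<^sup>*")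
proof -
  have pt: "(Pt i k, Snk) \<in> ?R\<^sup>*" if "i < n" for i k
    using that scale_small by (cases i) (auto intro!: r_into_rtrancl)
  have b1: "(B i k, Pt i k) \<in> ?R" if "i < n" "k = choice ph i \<or> other_set ph i" for i k
    using that pos(3) by auto
  have c: "(C i, B i (choice ph i)) \<in> ?R" if "i < n" for i using that by auto
  have cs: "(C i, Snk) \<in> ?R\<^sup>*" if "i < n" for i
    using c[OF that] b1[OF that] pt[OF that] by (meson converse_rtrancl_into_rtrancl)
  show ?thesis
  proof (cases s)
    case (B i k)
    have i: "i < n" using B assms by simp
    show ?thesis
    proof (cases "k = choice ph i \<or> other_set ph i")
      case True
      then show ?thesis using b1[OF i] pt[OF i] B by (meson converse_rtrancl_into_rtrancl)
    next
      case False
      then have "(s, C i) \<in> ?R" using B i by auto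
      then show ?thesis using cs[OF i] by (meson converse_rtrancl_into_rtrancl)
    qed
  next
    case (Sn j)
    have "0 < 1 - 2 * wA j - 2 * wZ j" using w_small[of j] Sn assms by simp
    then have "(s, Snk) \<in> ?R" using Sn assms by auto
    then show ?thesis by (rule r_into_rtrancl)
  qed (use assms pt cs in auto)
qed

sublocale coded_mdp SS av rw dl state_code action_code Snk "strategy (\<lambda>_. 0) (\<lambda>_. False)"
proof unfold_locales
  show "finite SS" by (rule finite_SS)
  show "inj_on state_code SS" using inj_state_code by (rule inj_on_subset) simp
  show "inj_on action_code (\<Union>s\<in>SS. av s)" by (rule inj_action_code)
  show "finite (av s)" for s by (cases s) auto
  show "av s \<inter> av t = {}" if "s \<noteq> t" for s t using that by (cases s; cases t) auto
  show "Snk \<in> SS" "\<exists>a. av Snk = {a} \<and> rw a = 0 \<and> dl a = [(1, Snk)]" by auto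
  show "strategy (\<lambda>_. 0) (\<lambda>_. False) s \<in> av s" for s by (rule strategy_av)
  show "(s, Snk) \<in> {(s, t). s \<in> SS \<and> (\<exists>w>0. (w, t) \<in> set (dl (strategy (\<lambda>_. 0) (\<lambda>_. False) s)))}\<^sup>*"
    if "s \<in> SS" for s using that by (rule strategy_reach)
  fix s a assume s: "s \<in> SS" "a \<in> av s"
  show "(\<Sum>(w, t)\<leftarrow>dl a. w) = 1"
  proof (cases s)
    case (Pt i k)
    then show ?thesis using s by (cases i) auto
  qed (use s in \<open>auto simp: algebra_simps\<close>)
  fix w t assume wt: "(w, t) \<in> set (dl a)"
  show "t \<in> SS \<and> 0 \<le> w"
  proof (cases s)
    case (B i k)
    then show ?thesis using s wt pos(3)[of i] eta_small[of i] eps by auto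
  next
    case (Pt i k)
    then show ?thesis using s wt pos(5) scale_small by (cases i) (auto split: if_splits)
  next
    case (Sn j)
    have "start j < n" "j < n" using start_le[of j] s Sn by auto
    then show ?thesis using Sn s wt pos(3,6,7) eta_small[of j] eta_small[of "start j"] eps w_small[of j]
      by (auto simp: less_imp_le)
  qed (use s wt in auto)
qed

lemma good_pol_strategy: "good_pol (strategy ph e)"
  using strategy_av strategy_reach by (auto simp: good_pol_def rel_def)

section \<open>Values and improving switches\<close>

text \<open>Value of the worse port. If level \<open>i\<close> is aligned, the worse port above it
  is the \<open>False\<close> one, whose averaging accounts for the extra
  \<open>gap (Suc i)\<close>.\<close>

fun low_port :: "(nat \<Rightarrow> nat) \<Rightarrow> nat \<Rightarrow> real" where
  "low_port ph 0 = 1"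
| "low_port ph (Suc i) = scale * low_port ph i + (if aligned ph i then gap (Suc i) else 0)"

definition port_val :: "(nat \<Rightarrow> nat) \<Rightarrow> nat \<Rightarrow> bool \<Rightarrow> real" where
  "port_val ph i k = low_port ph i + (if k = better ph i then gap i else 0)"
definition c_val :: "(nat \<Rightarrow> nat) \<Rightarrow> nat \<Rightarrow> real" where
  "c_val ph i = low_port ph i + (if aligned ph i then gap i else 0)"

fun core_val :: "(nat \<Rightarrow> nat) \<Rightarrow> state \<Rightarrow> real" where
  "core_val ph (C i) = c_val ph i"
| "core_val ph (B i k) = (if k = choice ph i then c_val ph i
     else if other_set ph i then (1 - eta i) * c_val ph i + eta i * port_val ph i k else c_val ph i - gam i / 3)"
| "core_val ph (Pt i k) = port_val ph i k"
| "core_val ph _ = 0"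

fun state_val :: "(nat \<Rightarrow> nat) \<Rightarrow> (nat \<Rightarrow> bool) \<Rightarrow> state \<Rightarrow> real" where
  "state_val ph e (Sn j) = ev (core_val ph) (if e j then S1 j else S0 j)"
| "state_val ph e s = core_val ph s"

text \<open>No action leads to a sensor, so sensor values never enter.\<close>

lemma ev_state_val: "ev (state_val ph e) a = ev (core_val ph) a"
  by (cases a rule: dl.cases) (auto simp: ev_def)

lemma port_val_choice: "port_val ph i (choice ph i) = c_val ph i"
  by (auto simp: port_val_def c_val_def choice_def)

lemma port_val_other: "port_val ph i (\<not> choice ph i) = c_val ph i + (if aligned ph i then - gap i else gap i)"
  by (auto simp: port_val_def c_val_def choice_def)

lemma port_val_Suc: "port_val ph (Suc i) True = scale * c_val ph i" "port_val ph (Suc i) False = scale / 2 * (port_val ph i True + port_val ph i False)"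
  using gap_Suc[of i] by (auto simp: port_val_def c_val_def algebra_simps)

lemma gap0: "gap 0 = 1" by (simp add: gap_def gap_exp_def)

lemma solves_state_val: "solves (strategy ph e) (state_val ph e)"
proof -
  have "state_val ph e s = ev (core_val ph) (strategy ph e s)" for s
  proof (cases s)
    case (B i k)
    then show ?thesis
      by (auto simp: ev_def algebra_simps port_val_choice)
  next
    case (Pt i k)
    then show ?thesis
    proof (cases i)
      case 0
      then show ?thesis using Pt by (auto simp: ev_def port_val_def gap0)
    next
      case (Suc i')
      then show ?thesis using Pt by (cases k) (auto simp: ev_def port_val_Suc distrib_left)
    qed
  qed (auto simp: ev_def)
  then show ?thesis by (simp add: solves_def ev_state_val)
qed

lemma low_port_ge: "gap i \<le> low_port ph i"
proof (induction i)
  case (Suc i)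
  have "scale * gap i \<le> scale * low_port ph i" using Suc pos(5) by simp
  then show ?case using gap_Suc[of i] pos(1)[of "Suc i"] by auto
qed (simp add: gap0)

lemma state_val_nonneg:
  assumes "s \<in> SS" shows "0 \<le> state_val ph (\<lambda>_. False) s"
proof -
  have port_val: "0 \<le> port_val ph i k" for i k using low_port_ge[of i ph] pos(1)[of i] by (auto simp: port_val_def)
  have c_val: "0 \<le> c_val ph i" for i using low_port_ge[of i ph] pos(1)[of i] by (auto simp: c_val_def)
  have core_val: "0 \<le> core_val ph (B i k)" if "i < n" for i k
  proof -
    have "gam i \<le> c_val ph i" using gam_le_gap[OF that] low_port_ge[of i ph] pos(1)[of i] by (auto simp: c_val_def)
    then show ?thesis using port_val[of i k] c_val[of i] pos(2,3)[of i] eta_small[OF that] eps by auto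
  qed
  show ?thesis
  proof (cases s)
    case (B i k)
    then show ?thesis using core_val assms by simp
  next
    case (Sn j)
    have "start j < n" "j < n" using start_le[of j] assms Sn by auto
    then have "0 \<le> 1 - eta j" "0 \<le> core_val ph (B (start j) True)" "0 \<le> core_val ph (B (start j) False)"
      using eta_small[of j] eps core_val by (linarith, blast, blast)
    then show ?thesis using Sn port_val[of j] c_val[of j] pos(3,4,6,7)[of j]
      by (auto simp: ev_def simp del: core_val.simps(2) intro!: add_nonneg_nonneg mult_nonneg_nonneg)
  qed (use port_val c_val in auto)
qed

text \<open>\<open>item ph i\<close> is the improving switch of an unfinished level \<open>i\<close>, and \<open>owner ph i\<close> its state.\<close>

definition item :: "(nat \<Rightarrow> nat) \<Rightarrow> nat \<Rightarrow> action" where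
  "item ph i = (if ph i = 3 then B1 i (\<not> choice ph i) else if ph i = 2 then CA i (\<not> choice ph i) else B0 i (\<not> choice ph i))"

definition owner :: "(nat \<Rightarrow> nat) \<Rightarrow> nat \<Rightarrow> state" where
  "owner ph i = (if ph i = 2 then C i else B i (\<not> choice ph i))"

definition gain :: "nat \<Rightarrow> real" where
  "gain p = (if p = 3 then 4 / 3 else if p = 2 then 1 else if p = 1 then 2 / 3 else 0)"

lemma owner_SS: "i < n \<Longrightarrow> owner ph i \<in> SS" and item_av: "item ph i \<in> av (owner ph i)"
  by (auto simp: owner_def item_def)

lemma phase_cases: "p \<le> 3 \<Longrightarrow> p = 0 \<or> p = 1 \<or> p = 2 \<or> p = (3::nat)"
  by auto

text \<open>With \<open>c\<close> the value of \<open>C i\<close>: opening lifts the path from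
  \<open>c - gam i / 3\<close> to \<open>c + gam i\<close>, the move exchanges \<open>c\<close> for
  \<open>c + gam i\<close>, and closing lifts the path from \<open>c - gam i\<close> to
  \<open>c - gam i / 3\<close>.\<close>

lemma item_gain:
  assumes "i < n" "ph i \<le> 3" "ph i \<noteq> 0"
  shows "ev (state_val ph e) (item ph i) - state_val ph e (owner ph i) = gain (ph i) * gam i"
  using phase_cases[OF assms(2)] assms(3) port_val_other[of ph i] gam_eq[OF assms(1)]
  by (auto simp: ev_state_val ev_def item_def owner_def gain_def aligned_def other_set_def algebra_simps)

text \<open>The total reduced cost of opening both paths of a level, in units of \<open>gam\<close>. It is negative exactly when
  the level rests, so that \<open>3 * sensor_in p - 9 * sensor_in q - 5\<close> is positive exactly if the level with phase
  \<open>p\<close> does not rest and the level with phase \<open>q\<close> does.\<close>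

definition sensor_in :: "nat \<Rightarrow> real" where
  "sensor_in p = (if p = 3 then 4 / 3 else if p = 0 then - 2 / 3 else 0)"

lemma sensor_in_eq:
  assumes "i < n" "ph i \<le> 3"
  shows "2 * (1 - eta i) * c_val ph i + eta i * port_val ph i True + eta i * port_val ph i False
    - core_val ph (B i True) - core_val ph (B i False) = sensor_in (ph i) * gam i"
proof -
  have "eta i * port_val ph i True + eta i * port_val ph i False = eta i * port_val ph i (choice ph i) + eta i * port_val ph i (\<not> choice ph i)"
    "core_val ph (B i True) + core_val ph (B i False) = core_val ph (B i (choice ph i)) + core_val ph (B i (\<not> choice ph i))"
    by (cases "choice ph i"; simp)+
  then have "2 * (1 - eta i) * c_val ph i + eta i * port_val ph i True + eta i * port_val ph i False
    - core_val ph (B i True) - core_val ph (B i False) = 2 * (1 - eta i) * c_val ph i + eta i * port_val ph i (choice ph i)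
      + eta i * port_val ph i (\<not> choice ph i) - core_val ph (B i (choice ph i)) - core_val ph (B i (\<not> choice ph i))"
    by linarith
  also have "\<dots> = sensor_in (ph i) * gam i"
    using phase_cases[OF assms(2)] gam_eq[OF assms(1)]
    by (auto simp: port_val_choice port_val_other sensor_in_def aligned_def other_set_def algebra_simps)
  finally show ?thesis .
qed

lemma sensor_gain:
  assumes j: "j < n" and ph: "\<And>i. ph i \<le> 3"
  shows "ev (core_val ph) (S1 j) - ev (core_val ph) (S0 j) = (3 * sensor_in (ph (start j)) - 9 * sensor_in (ph j) - 5) * tau j"
proof -
  let ?s = "start j"
  have s: "?s < n" using start_le[of j] j by simp
  have "ev (core_val ph) (S1 j) - ev (core_val ph) (S0 j) =
      wA j * (2 * (1 - eta ?s) * c_val ph ?s + eta ?s * port_val ph ?s True + eta ?s * port_val ph ?s False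
         - core_val ph (B ?s True) - core_val ph (B ?s False))
      - wZ j * (2 * (1 - eta j) * c_val ph j + eta j * port_val ph j True + eta j * port_val ph j False
         - core_val ph (B j True) - core_val ph (B j False)) - 5 * tau j"
    by (simp add: ev_def algebra_simps del: core_val.simps(2))
  also have "\<dots> = wA j * (sensor_in (ph ?s) * gam ?s) - wZ j * (sensor_in (ph j) * gam j) - 5 * tau j"
    unfolding sensor_in_eq[OF s ph] sensor_in_eq[OF j ph] by simp
  also have "\<dots> = (3 * sensor_in (ph ?s) - 9 * sensor_in (ph j) - 5) * tau j"
    using pos(2)[of j] pos(2)[of ?s] by (simp add: wA_def wZ_def field_simps)
  finally show ?thesis .
qed

text \<open>A resting level \<open>j\<close> contributes 6, just above the threshold 5, and an
  unfinished \<open>start j\<close> adds 0 or 4. If \<open>start j\<close> rests, its -2 spoils the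
  surplus; if \<open>j\<close> is unfinished, 4 alone stays below 5.\<close>

lemma sensor_gain_cases:
  assumes j: "j < n" and ph: "\<And>i. ph i \<le> 3"
  shows "ph (start j) \<noteq> 0 \<Longrightarrow> ph j = 0 \<Longrightarrow>
      tau j \<le> ev (core_val ph) (S1 j) - ev (core_val ph) (S0 j) \<and> ev (core_val ph) (S1 j) - ev (core_val ph) (S0 j) \<le> 5 * tau j"
    and "ph (start j) = 0 \<or> ph j \<noteq> 0 \<Longrightarrow> ev (core_val ph) (S1 j) - ev (core_val ph) (S0 j) \<le> 0"
proof -
  show "ph (start j) \<noteq> 0 \<Longrightarrow> ph j = 0 \<Longrightarrow>
      tau j \<le> ev (core_val ph) (S1 j) - ev (core_val ph) (S0 j) \<and> ev (core_val ph) (S1 j) - ev (core_val ph) (S0 j) \<le> 5 * tau j"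
    unfolding sensor_gain[OF assms] using pos(4)[of j] by (auto simp: sensor_in_def)
  show "ph (start j) = 0 \<or> ph j \<noteq> 0 \<Longrightarrow> ev (core_val ph) (S1 j) - ev (core_val ph) (S0 j) \<le> 0"
    unfolding sensor_gain[OF assms] using pos(4)[of j] by (auto simp: sensor_in_def mult_le_0_iff)
qed

definition on_items :: "(nat \<Rightarrow> nat) \<Rightarrow> action set" where
  "on_items ph = item ph ` {i. i < n \<and> ph i \<noteq> 0} \<union> S1 ` {j. j < n \<and> ph (start j) \<noteq> 0 \<and> ph j = 0}"

text \<open>For the converse direction, keeping the current action gains nothing, so only the
  alternative action at each state matters, and the phases decide the sign of its gain.\<close>

lemma improving_iff:
  assumes ph: "\<And>i. ph i \<le> 3" and s: "s \<in> SS" and a: "a \<in> av s"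
  shows "state_val ph (\<lambda>_. False) s < ev (state_val ph (\<lambda>_. False)) a \<longleftrightarrow>
    (\<exists>i<n. ph i \<noteq> 0 \<and> s = owner ph i \<and> a = item ph i) \<or> (\<exists>j<n. ph (start j) \<noteq> 0 \<and> ph j = 0 \<and> s = Sn j \<and> a = S1 j)"
  (is "?l \<longleftrightarrow> ?r")
proof
  assume ?r
  then show ?l
  proof (elim disjE exE conjE)
    fix i assume i: "i < n" "ph i \<noteq> 0" "s = owner ph i" "a = item ph i"
    have "0 < gain (ph i) * gam i" using i(2) phase_cases[OF ph[of i]] pos(2)[of i] by (auto simp: gain_def)
    then show ?l using item_gain[where ph = ph, OF i(1) ph i(2)] i by (metis diff_gt_0_iff_gt)
  next
    fix j assume j: "j < n" "ph (start j) \<noteq> 0" "ph j = 0" "s = Sn j" "a = S1 j"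
    then show ?l using sensor_gain_cases(1)[where ph = ph, OF j(1) ph j(2,3)] pos(4)[of j] by (simp add: ev_state_val)
  qed
next
  assume l: ?l
  show ?r
  proof (cases s)
    case Snk
    then show ?thesis using l a by (simp add: ev_def)
  next
    case (C i)
    then obtain k where k: "a = CA i k" using a by auto
    have nk: "k = (\<not> choice ph i)"
    proof (rule ccontr)
      assume "k \<noteq> (\<not> choice ph i)"
      then have "k = choice ph i" by auto
      then show False using l C k by (simp add: ev_def)
    qed
    have "eta i * gap i = gam i" using gam_eq[of i] C s by simp
    then have "core_val ph (B i k) = (if other_set ph i then c_val ph i + (if aligned ph i then - gam i else gam i) else c_val ph i - gam i / 3)"
      unfolding nk by (simp add: port_val_other algebra_simps)
    moreover have "c_val ph i < core_val ph (B i k)" using l C k unfolding ev_state_val by (simp add: ev_def del: core_val.simps(2))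
    ultimately have "ph i = 2"
      using phase_cases[OF ph[of i]] pos(2)[of i] by (auto simp: other_set_def aligned_def split: if_splits)
    then show ?thesis using C k s nk by (auto simp: owner_def item_def)
  next
    case (B i k)
    have i: "i < n" using B s by simp
    have sm: "eta i * gap i = gam i" using gam_eq[OF i] by simp
    show ?thesis
    proof (cases "k = choice ph i")
      case True
      then have "port_val ph i k = c_val ph i" "core_val ph (B i k) = c_val ph i" using port_val_choice by simp_all
      then have "ev (core_val ph) (B0 i k) = c_val ph i - gam i / 3" "ev (core_val ph) (B1 i k) = c_val ph i"
        by (simp_all add: ev_def algebra_simps)
      then show ?thesis using l B a \<open>core_val ph (B i k) = c_val ph i\<close> pos(2)[of i]
        unfolding ev_state_val by (auto simp del: core_val.simps(2))
    next
      case False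
      then have k: "k = (\<not> choice ph i)" by auto
      have b: "core_val ph (B i k) = (if other_set ph i then c_val ph i + (if aligned ph i then - gam i else gam i) else c_val ph i - gam i / 3)"
        unfolding k using sm by (simp add: port_val_other algebra_simps)
      have e0: "ev (core_val ph) (B0 i k) = c_val ph i - gam i / 3" by (simp add: ev_def)
      have e1: "ev (core_val ph) (B1 i k) = c_val ph i + (if aligned ph i then - gam i else gam i)"
        unfolding k using sm by (simp add: ev_def port_val_other algebra_simps)
      have lt: "core_val ph (B i k) < ev (core_val ph) a" using l B unfolding ev_state_val by (simp del: core_val.simps(2))
      have "a = B0 i k \<or> a = B1 i k" using a B by simp
      then have "a = B0 i k \<and> ph i = 1 \<or> a = B1 i k \<and> ph i = 3"
      proof
        assume "a = B0 i k"
        then show ?thesis using lt[unfolded b] e0 phase_cases[OF ph[of i]] pos(2)[of i]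
          by (simp add: other_set_def aligned_def split: if_splits; linarith)
      next
        assume "a = B1 i k"
        then show ?thesis using lt[unfolded b] e1 phase_cases[OF ph[of i]] pos(2)[of i]
          by (simp add: other_set_def aligned_def split: if_splits; linarith)
      qed
      then have "a = item ph i \<and> ph i \<noteq> 0 \<and> ph i \<noteq> 2" using k by (auto simp: item_def)
      then show ?thesis using B k i by (auto simp: owner_def)
    qed
  next
    case (Pt i k)
    then have "a = strategy ph (\<lambda>_. False) s" using a by simp
    then have "state_val ph (\<lambda>_. False) s = ev (state_val ph (\<lambda>_. False)) a"
      using solves_state_val[of ph "\<lambda>_. False"] s unfolding solves_def by blast
    then show ?thesis using l by simp
  next
    case (Sn j)
    then have "j < n" "a = S1 j" using s a l by (auto simp: ev_state_val)
    moreover have "\<not> (ph (start j) = 0 \<or> ph j \<noteq> 0)"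
    proof
      assume "ph (start j) = 0 \<or> ph j \<noteq> 0"
      from sensor_gain_cases(2)[where ph = ph, OF \<open>j < n\<close> ph this]
      show False using l Sn \<open>a = S1 j\<close> by (simp add: ev_state_val)
    qed
    ultimately show ?thesis using Sn by simp
  qed
qed

definition config :: "(nat \<Rightarrow> nat) \<Rightarrow> nat \<Rightarrow> nat" where "config ph = pol (strategy ph (\<lambda>_. False))"

lemma improving_config:
  assumes ph: "\<And>i. ph i \<le> 3"
  shows "improving M (config ph) = action_code ` on_items ph"
proof -
  have "(\<exists>s\<in>SS. a \<in> av s \<and> state_val ph (\<lambda>_. False) s < ev (state_val ph (\<lambda>_. False)) a) \<longleftrightarrow> a \<in> on_items ph" for a
  proof -
    have Sn: "Sn j \<in> SS \<and> S1 j \<in> av (Sn j)" if "j < n" for j using that by simp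
    have "(\<exists>s\<in>SS. a \<in> av s \<and> state_val ph (\<lambda>_. False) s < ev (state_val ph (\<lambda>_. False)) a) \<longleftrightarrow>
      (\<exists>s\<in>SS. a \<in> av s \<and> ((\<exists>i<n. ph i \<noteq> 0 \<and> s = owner ph i \<and> a = item ph i)
        \<or> (\<exists>j<n. ph (start j) \<noteq> 0 \<and> ph j = 0 \<and> s = Sn j \<and> a = S1 j)))"
      by (intro bex_cong refl conj_cong improving_iff[where ph = ph, OF ph])
    also have "\<dots> \<longleftrightarrow> (\<exists>i<n. ph i \<noteq> 0 \<and> a = item ph i) \<or> (\<exists>j<n. ph (start j) \<noteq> 0 \<and> ph j = 0 \<and> a = S1 j)"
      using owner_SS[of _ ph] item_av[of ph] Sn by blast
    also have "\<dots> \<longleftrightarrow> a \<in> on_items ph" unfolding on_items_def by blast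
    finally show ?thesis .
  qed
  then show ?thesis unfolding config_def improving_M[OF solves_state_val good_pol_strategy] by simp
qed

text \<open>With all phases 0 no switch is improving.\<close>

lemma weak_unichain_M: "weak_unichain_mdp M"
proof (rule optimal_pol[OF solves_state_val good_pol_strategy])
  fix s a assume "s \<in> SS" "a \<in> av s"
  then show "ev (state_val (\<lambda>_. 0) (\<lambda>_. False)) a \<le> state_val (\<lambda>_. 0) (\<lambda>_. False) s"
    using improving_iff[of "\<lambda>_. 0" s a] by (auto simp: not_less[symmetric])
qed (rule state_val_nonneg)

section \<open>Steps of the counter\<close>

text \<open>A move at level \<open>i\<close> leaves the actions of all higher levels as they are but
  reverses which port is better, at each of them in turn; \<open>3 - ph j\<close> flips the
  alignment and keeps \<open>other_set\<close>.\<close>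

definition step :: "nat \<Rightarrow> (nat \<Rightarrow> nat) \<Rightarrow> nat \<Rightarrow> nat" where
  "step i ph j = (if j = i then ph i - 1 else if i < j \<and> ph i = 2 then 3 - ph j else ph j)"

lemma aligned_step:
  assumes "ph j \<le> 3" "ph i \<noteq> 0"
  shows "aligned (step i ph) j \<longleftrightarrow> (if ph i = 2 \<and> i \<le> j then \<not> aligned ph j else aligned ph j)"
  using assms by (auto simp: aligned_def step_def)

lemma better_step:
  assumes "\<And>j. ph j \<le> 3" "ph i \<noteq> 0"
  shows "better (step i ph) j \<longleftrightarrow> (if ph i = 2 \<and> i < j then \<not> better ph j else better ph j)"
  using aligned_step[where ph = ph, OF assms(1) assms(2)] by (cases j) auto

lemma choice_step:
  assumes "\<And>j. ph j \<le> 3" "ph i \<noteq> 0"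
  shows "choice (step i ph) j \<longleftrightarrow> (if ph i = 2 \<and> i = j then \<not> choice ph j else choice ph j)"
  unfolding choice_def better_step[where ph = ph, OF assms] aligned_step[where ph = ph, OF assms] by auto

lemma other_set_step:
  assumes "ph j \<le> 3" "ph i \<le> 3" "ph i \<noteq> 0"
  shows "other_set (step i ph) j \<longleftrightarrow> (if j = i then ph i \<noteq> 1 else other_set ph j)"
  using assms by (auto simp: other_set_def step_def)

lemma strategy_switch:
  assumes "\<And>j. ph j \<le> 3" "ph i \<noteq> 0"
  shows "(strategy ph e)(owner ph i := item ph i) = strategy (step i ph) e"
proof
  fix s
  have i: "ph i = 1 \<or> ph i = 2 \<or> ph i = 3" using phase_cases[OF assms(1)[of i]] assms(2) by simp
  show "((strategy ph e)(owner ph i := item ph i)) s = strategy (step i ph) e s"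
    using i by (cases s)
      (auto simp: choice_step[where ph = ph, OF assms] other_set_step[where ph = ph, OF assms(1,1,2)] owner_def item_def, auto simp: other_set_def)
qed

lemma low_port_step:
  assumes "\<And>j. ph j \<le> 3" "ph i \<noteq> 0" "ph i \<noteq> 2 \<or> j \<le> i"
  shows "low_port (step i ph) j = low_port ph j"
  using assms(3) by (induction j) (auto simp: aligned_step[where ph = ph, OF assms(1,2)])

section \<open>Value increases and agreement of the rankings\<close>

definition jump :: "(nat \<Rightarrow> nat) \<Rightarrow> nat \<Rightarrow> real" where
  "jump ph i = (if ph i = 2 then gap i else gain (ph i) * gam i)"

text \<open>After the move in phase 2, \<open>C i\<close> returns to the new path until the better
  port is reached, which yields the full \<open>gap i\<close>. In the other phases
  \<open>C i\<close> does not use the switched path, so the increase is just the reduced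
  cost.\<close>

lemma value_jump:
  assumes "i < n" "\<And>j. ph j \<le> 3" "ph i \<noteq> 0"
  shows "state_val (step i ph) e (owner ph i) - state_val ph e (owner ph i) = jump ph i"
proof -
  have i: "ph i = 1 \<or> ph i = 2 \<or> ph i = 3" using phase_cases[OF assms(2)[of i]] assms(3) by simp
  show ?thesis
  proof (cases "ph i = 2")
    case True
    then have "\<not> aligned ph i" by (simp add: aligned_def)
    then show ?thesis using low_port_step[where ph = ph, OF assms(2,3), of i] True
      by (simp add: owner_def jump_def c_val_def aligned_step[where ph = ph, OF assms(2,3)])
  next
    case False
    then have "c_val (step i ph) i = c_val ph i" "port_val (step i ph) i = port_val ph i"
      using low_port_step[where ph = ph, OF assms(2,3), of i]
      by (auto simp: c_val_def port_val_def fun_eq_iff aligned_step[where ph = ph, OF assms(2,3)] better_step[where ph = ph, OF assms(2,3)])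
    then show ?thesis using False i port_val_other[of ph i] gam_eq[OF assms(1)]
      by (auto simp: owner_def jump_def gain_def choice_step[where ph = ph, OF assms(2,3)] other_set_step[where ph = ph, OF assms(2,2,3)]
         algebra_simps) (auto simp: other_set_def aligned_def algebra_simps)
  qed
qed

definition li_inc :: "(nat \<Rightarrow> nat) \<Rightarrow> action \<Rightarrow> real" where
  "li_inc ph a = (\<Sum>t \<in> St M. val M (switch M (config ph) (action_code a)) t) - (\<Sum>t \<in> St M. val M (config ph) t)"

lemma li_le_iff: "li_le M (config ph) (action_code a) (action_code b) \<longleftrightarrow> li_inc ph a \<le> li_inc ph b"
  by (simp add: li_le_def li_inc_def)

lemma jump_pos: "ph i \<le> 3 \<Longrightarrow> ph i \<noteq> 0 \<Longrightarrow> 0 < jump ph i"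
  using phase_cases[of "ph i"] pos(1,2)[of i] by (auto simp: jump_def gain_def)

lemma li_inc_item:
  assumes "i < n" "\<And>j. ph j \<le> 3" "ph i \<noteq> 0"
  shows "jump ph i \<le> li_inc ph (item ph i)" "li_inc ph (item ph i) \<le> real (card SS) * jump ph i"
proof -
  note sw = strategy_switch[where ph = ph, OF assms(2,3), of "\<lambda>_. False"]
  note vj = value_jump[where ph = ph, OF assms, of "\<lambda>_. False"]
  note * = li_gain[OF solves_state_val[of ph "\<lambda>_. False"] good_pol_strategy owner_SS[OF assms(1), of ph] item_av,
      unfolded sw, OF solves_state_val good_pol_strategy, folded config_def]
  show "jump ph i \<le> li_inc ph (item ph i)" "li_inc ph (item ph i) \<le> real (card SS) * jump ph i"
    using * vj jump_pos[where ph = ph, OF assms(2,3)] unfolding li_inc_def by auto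
qed

lemma li_inc_sensor:
  fixes ph defines "U \<equiv> \<lambda>j. ev (core_val ph) (S1 j) - ev (core_val ph) (S0 j)"
  assumes "j < n" "0 \<le> U j"
  shows "U j \<le> li_inc ph (S1 j)" "li_inc ph (S1 j) \<le> real (card SS) * U j"
proof -
  have sw: "(strategy ph (\<lambda>_. False))(Sn j := S1 j) = strategy ph (\<lambda>k. k = j)"
  proof
    fix s show "((strategy ph (\<lambda>_. False))(Sn j := S1 j)) s = strategy ph (\<lambda>k. k = j) s" by (cases s) auto
  qed
  have "S1 j \<in> av (Sn j)" by simp
  note * = li_gain[OF solves_state_val[of ph "\<lambda>_. False"] good_pol_strategy _ this,
      unfolded sw, OF _ solves_state_val good_pol_strategy, folded config_def]
  show "U j \<le> li_inc ph (S1 j)" "li_inc ph (S1 j) \<le> real (card SS) * U j"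
    using * assms(2,3) unfolding li_inc_def U_def by auto
qed

text \<open>All configurations of the run have this shape, for the level \<open>i\<close> at which the counter works.\<close>

definition frontier :: "nat \<Rightarrow> (nat \<Rightarrow> nat) \<Rightarrow> bool" where
  "frontier i ph \<longleftrightarrow> i < n \<and> (\<forall>j. ph j \<le> 3) \<and> ph i \<noteq> 0 \<and> (\<forall>j<i. ph j = 1 \<or> ph j = 3) \<and> (\<forall>j. i < j \<and> j < n \<longrightarrow> ph j = 0)"

lemma frontierD:
  assumes "frontier i ph"
  shows "i < n" "\<And>j. ph j \<le> 3" "ph i \<noteq> 0" "\<And>j. j < n \<Longrightarrow> ph j \<noteq> 0 \<longleftrightarrow> j \<le> i"
    "\<And>j. j < i \<Longrightarrow> ph j \<noteq> 2"
proof -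
  show "i < n" "\<And>j. ph j \<le> 3" "ph i \<noteq> 0" using assms by (auto simp: frontier_def)
  show "ph j \<noteq> 2" if "j < i" for j using assms that by (auto simp: frontier_def)
  show "ph j \<noteq> 0 \<longleftrightarrow> j \<le> i" if "j < n" for j
    using assms that unfolding frontier_def by (metis le_eq_less_or_eq linorder_not_le zero_neq_numeral zero_neq_one)
qed

lemma on_items_frontier:
  assumes "frontier i ph"
  shows "on_items ph = item ph ` {..i} \<union> S1 ` {j. i < j \<and> j < n \<and> start j \<le> i}"
proof -
  have "{j. j < n \<and> ph j \<noteq> 0} = {..i}" using frontierD[OF assms] by auto
  moreover have "{j. j < n \<and> ph (start j) \<noteq> 0 \<and> ph j = 0} = {j. i < j \<and> j < n \<and> start j \<le> i}"
    using frontierD(4)[OF assms] start_le le_less_trans by (smt (verit) Collect_cong linorder_not_le)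
  ultimately show ?thesis unfolding on_items_def by simp
qed

lemma key_item [simp]: "key (item ph j) = gam_exp j" by (simp add: item_def)

lemma key_inj:
  assumes "frontier i ph" shows "inj_on key (on_items ph)"
proof (rule inj_onI)
  fix a b assume a: "a \<in> on_items ph" and b: "b \<in> on_items ph" and eq: "key a = key b"
  have tn: "gam_exp j \<noteq> tau_exp k" "tau_exp k \<noteq> gam_exp j" if "j \<le> i" for j k
    using gam_exp_less_tau_exp[of j k] frontierD(1)[OF assms] that by auto
  show "a = b"
    using a b eq tn gam_exp_eq_iff frontierD(1)[OF assms] unfolding on_items_frontier[OF assms] by auto
qed

lemma on_items_A: assumes "frontier i ph" shows "on_items ph \<subseteq> A"
  using on_items_frontier[OF assms] AI[OF owner_SS item_av] AI[of "Sn _" "S1 _"] frontierD(1)[OF assms] by fastforce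

lemma code_less_iff:
  assumes "frontier i ph" "a \<in> on_items ph" "b \<in> on_items ph"
  shows "action_code a < action_code b \<longleftrightarrow> key a < key b"
proof -
  have "key a = key b \<Longrightarrow> a = b" using key_inj[OF assms(1)] assms(2,3) by (auto simp: inj_on_def)
  then show ?thesis using kind_less[of a] kind_less[of b] by (cases "key a = key b") (auto simp: action_code_def)
qed

text \<open>The reduced cost of the move of \<open>C i\<close> is only \<open>gam i\<close>, like that of opening its path, but the
  move raises the value of \<open>C i\<close> by the whole \<open>gap i\<close>.\<close>

definition li_key :: "nat \<Rightarrow> (nat \<Rightarrow> nat) \<Rightarrow> action \<Rightarrow> nat" where
  "li_key i ph a = (if a = item ph i \<and> ph i = 2 then gap_exp i else key a)"

text \<open>Lowering the key of the move to \<open>gap_exp i\<close> could only let it overtake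
  items that beat it. These belong to levels \<open>j < i\<close> with
  \<open>cover j \<le> i\<close>, for which even \<open>gam_exp j < gap_exp i\<close>.\<close>

lemma li_key_less:
  assumes "frontier i ph" "a \<in> on_items ph" "b \<in> on_items ph" "key a < key b"
  shows "li_key i ph a < li_key i ph b"
proof (cases "b = item ph i \<and> ph i = 2")
  case True
  have i: "i < n" using frontierD(1)[OF assms(1)] .
  have "\<not> tau_exp j < gam_exp i" for j using gam_exp_less_tau_exp[OF i, of j] by simp
  then obtain j where j: "j \<le> i" "a = item ph j"
    using assms(2,4) True unfolding on_items_frontier[OF assms(1)] by auto
  then have "gam_exp j < gam_exp i" using assms(4) True by simp
  then have "j < i" using j by (cases "j = i") auto
  then have "gam_exp j < gap_exp i" using gam_exp_less_iff[OF _ i] gam_exp_less_gap_exp[OF _ i] \<open>gam_exp j < gam_exp i\<close> by blast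
  moreover have "a \<noteq> item ph i" using \<open>gam_exp j < gam_exp i\<close> j by (metis key_item less_irrefl)
  ultimately show ?thesis using True j by (simp add: li_key_def)
next
  case False
  have "li_key i ph a \<le> key a" using gap_exp_less_gam_exp[OF frontierD(1)[OF assms(1)]] by (auto simp: li_key_def)
  moreover have "li_key i ph b = key b" using False by (auto simp: li_key_def)
  ultimately show ?thesis using assms(4) by linarith
qed

lemma rc_bounds:
  assumes "frontier i ph" "a \<in> on_items ph"
  shows "2 / 3 * eps ^ key a \<le> rc M (config ph) (action_code a) \<and> rc M (config ph) (action_code a) \<le> 5 * eps ^ key a"
proof -
  note I = frontierD[OF assms(1)]
  consider j where "j \<le> i" "a = item ph j" | j where "i < j" "j < n" "start j \<le> i" "a = S1 j"
    using assms(2) unfolding on_items_frontier[OF assms(1)] by auto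
  then show ?thesis
  proof cases
    case 1
    then have j: "j < n" "ph j \<noteq> 0" using I by auto
    then have "rc M (config ph) (action_code a) = gain (ph j) * gam j"
      unfolding config_def using rc_M[OF solves_state_val good_pol_strategy owner_SS item_av] item_gain[where ph = ph, OF _ I(2)] 1 by simp
    moreover have "2 / 3 \<le> gain (ph j)" "gain (ph j) \<le> 5"
      using phase_cases[OF I(2)[of j]] j by (auto simp: gain_def)
    ultimately show ?thesis using 1 pos(2)[of j] by (simp add: gam_def)
  next
    case 2
    have "S1 j \<in> av (Sn j)" "Sn j \<in> SS" using 2 by auto
    then have "rc M (config ph) (action_code a) = ev (core_val ph) (S1 j) - ev (core_val ph) (S0 j)"
      unfolding config_def using rc_M[OF solves_state_val good_pol_strategy, of "Sn j" "S1 j" ph "\<lambda>_. False"] 2 by (simp add: ev_state_val)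
    moreover have "ph (start j) \<noteq> 0" "ph j = 0" using 2 I(4)[of j] I(4)[of "start j"] start_le[of j] by auto
    ultimately show ?thesis using sensor_gain_cases(1)[where ph = ph and j = j] 2 I(2) pos(4)[of j]
      by (simp add: tau_def)
  qed
qed

lemma li_bounds:
  assumes "frontier i ph" "a \<in> on_items ph"
  shows "2 / 3 * eps ^ li_key i ph a \<le> li_inc ph a \<and> li_inc ph a \<le> real (card SS) * (5 * eps ^ li_key i ph a)"
proof -
  note I = frontierD[OF assms(1)]
  consider j where "j \<le> i" "a = item ph j" | j where "i < j" "j < n" "start j \<le> i" "a = S1 j"
    using assms(2) unfolding on_items_frontier[OF assms(1)] by auto
  \<comment> \<open>\<open>U\<close> is the value increase at the switched state alone.\<close>
  then have "\<exists>U. U \<le> li_inc ph a \<and> li_inc ph a \<le> real (card SS) * U \<and> 2 / 3 * eps ^ li_key i ph a \<le> U \<and> U \<le> 5 * eps ^ li_key i ph a"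
  proof cases
    case 1
    then have j: "j < n" "ph j \<noteq> 0" using I by auto
    have eq: "item ph j = item ph i \<longleftrightarrow> j = i" using gam_exp_eq_iff[OF j(1) I(1)] by (metis key_item)
    have "2 / 3 * eps ^ li_key i ph a \<le> jump ph j \<and> jump ph j \<le> 5 * eps ^ li_key i ph a"
    proof (cases "ph j = 2")
      case True
      then have "j = i" using I(5)[of j] 1 by (cases "j = i") auto
      then show ?thesis using True 1 pos(1)[of i] by (simp add: jump_def li_key_def gap_def)
    next
      case False
      have "2 / 3 \<le> gain (ph j)" "gain (ph j) \<le> 5"
        using phase_cases[OF I(2)[of j]] j by (auto simp: gain_def)
      moreover have "li_key i ph a = gam_exp j" using False eq 1 by (auto simp: li_key_def)
      ultimately show ?thesis using False pos(2)[of j] by (simp add: jump_def gam_def)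
    qed
    then show ?thesis using li_inc_item[where ph = ph, OF j(1) I(2) j(2)] 1 by blast
  next
    case 2
    have ph: "ph (start j) \<noteq> 0" "ph j = 0" using 2 I(4)[of j] I(4)[of "start j"] start_le[of j] by auto
    have "a \<noteq> item ph i" using gam_exp_less_tau_exp[OF I(1), of j] 2 by (metis key.simps(7) key_item less_irrefl)
    then have "li_key i ph a = tau_exp j" using 2 by (simp add: li_key_def)
    then show ?thesis using sensor_gain_cases(1)[where ph = ph and j = j, OF _ I(2) ph] 2 li_inc_sensor[of j ph] pos(4)[of j]
      by (intro exI[of _ "ev (core_val ph) (S1 j) - ev (core_val ph) (S0 j)"]) (auto simp: tau_def)
  qed
  then show ?thesis by (meson mult_left_mono of_nat_0_le_iff order_trans)
qed

text \<open>One factor \<open>eps\<close> absorbs the constant 5 and the possible number of states: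
  \<open>5 * (6 / 100) < 2 / 3\<close>.\<close>

lemma separated:
  assumes "2 / 3 * eps ^ p \<le> x" "y \<le> c * (5 * eps ^ q)" "p < q" "0 \<le> c" "c \<le> 6 * real n + 1"
  shows "y < x"
proof -
  have "c * (5 * eps ^ q) \<le> (6 * real n + 1) * (5 * (eps * eps ^ p))"
    using assms(4,5) eps_power_less[OF assms(3)] eps by (intro mult_mono) auto
  also have "\<dots> = 5 * (eps * (6 * real n + 1)) * eps ^ p" by (simp add: algebra_simps)
  also have "\<dots> \<le> 5 * (6 / 100) * eps ^ p" using eps by (intro mult_right_mono mult_left_mono) auto
  also have "\<dots> < 2 / 3 * eps ^ p" using eps by simp
  finally show ?thesis using assms by linarith
qed

lemma pivot_dom_config:
  assumes "frontier i ph" shows "pivot_dom M (config ph)"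
proof -
  have "improving M (config ph) \<noteq> {}"
    using improving_config[where ph = ph, OF frontierD(2)[OF assms]] on_items_frontier[OF assms] by auto
  then show ?thesis unfolding pivot_dom_def config_def
    using is_mdp_M proper_weak_unichain[OF is_mdp_M proper_pol[OF good_pol_strategy]] by blast
qed

lemma agree_config:
  assumes frontier: "frontier i ph" shows "agree M (config ph)"
proof -
  have card: "real (card SS) \<le> 6 * real n + 1" using card_SS by linarith
  have less: "rc M (config ph) (action_code b) < rc M (config ph) (action_code a) \<and> li_inc ph b < li_inc ph a"
    if ab: "a \<in> on_items ph" "b \<in> on_items ph" and l: "action_code a < action_code b" for a b
  proof
    have k: "key a < key b" using code_less_iff[OF frontier ab] l by simp
    show "rc M (config ph) (action_code b) < rc M (config ph) (action_code a)"
      by (rule separated[where c = 1, OF _ _ k]) (use rc_bounds[OF frontier] ab in auto)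
    show "li_inc ph b < li_inc ph a"
      by (rule separated[where c = "real (card SS)", OF _ _ li_key_less[OF frontier ab k]]) (use li_bounds[OF frontier] ab card in auto)
  qed
  have "(dantzig_le M (config ph) (action_code a) (action_code b) \<longleftrightarrow> bland_le M (config ph) (action_code a) (action_code b)) \<and>
     (li_le M (config ph) (action_code a) (action_code b) \<longleftrightarrow> bland_le M (config ph) (action_code a) (action_code b))"
    if ab: "a \<in> on_items ph" "b \<in> on_items ph" for a b
  proof (cases "action_code a" "action_code b" rule: linorder_cases)
    case equal
    then have "a = b" using inj_onD[OF inj_eA[folded A_def]] on_items_A[OF frontier] ab by blast
    then show ?thesis by (simp add: dantzig_le_def li_le_iff bland_le_def)
  qed (use less[OF ab] less[OF ab(2,1)] in \<open>auto simp: dantzig_le_def li_le_iff bland_le_def\<close>)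
  then show ?thesis using pivot_dom_config[OF frontier]
    unfolding agree_def improving_config[where ph = ph, OF frontierD(2)[OF frontier]] by blast
qed

text \<open>The improving switches ahead of the item of level \<open>i\<close> are the items of the
  levels with \<open>cover j \<le> i\<close>, while sensors all come behind. So its rank is
  \<open>low i\<close>, which by \<open>g_card\<close> is the position that \<Pi> chooses for this
  number of switches.\<close>

lemma picks_item:
  assumes \<Pi>: "pivot_rule \<Pi>" "ranking_based \<Pi>" "\<And>k. g k = pick \<Pi> (Suc k)" and frontier: "frontier i ph"
  shows "\<Pi> M (config ph) = action_code (item ph i)"
proof (rule rule_eqI[OF \<Pi>(1,2) agree_config[OF frontier]])
  note I = frontierD[OF frontier]
  have inj: "inj_on action_code (on_items ph)"
    using inj_eA on_items_A[OF frontier] by (auto simp: A_def intro: inj_on_subset)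
  have item: "item ph j \<in> on_items ph" if "j \<le> i" for j using on_items_frontier[OF frontier] that by auto
  show "action_code (item ph i) \<in> improving M (config ph)" using improving_config[where ph = ph, OF I(2)] item by auto
  have inj_item: "inj_on (item ph) {..i}"
    using gam_exp_eq_iff I(1) by (intro inj_onI) (metis atMost_iff key_item le_less_trans)
  have "item ph ` {..i} \<inter> S1 ` {j. i < j \<and> j < n \<and> start j \<le> i} = {}"
    by (auto simp: item_def)
  then have "card (on_items ph) = Suc i + card {j. i < j \<and> j < n \<and> start j \<le> i}"
    unfolding on_items_frontier[OF frontier] using inj_item by (subst card_Un_disjoint) (auto simp: card_image inj_on_def)
  then have c: "pick \<Pi> (card (improving M (config ph))) = low i"
    using g_card[OF I(1)] \<Pi>(3) improving_config[where ph = ph, OF I(2)] card_image[OF inj] by simp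
  have "{b \<in> improving M (config ph). b < action_code (item ph i)} = action_code ` {a \<in> on_items ph. key a < gam_exp i}"
    using code_less_iff[OF frontier _ item] improving_config[where ph = ph, OF I(2)] by auto
  also have "{a \<in> on_items ph. key a < gam_exp i} = item ph ` {j. j < i \<and> cover j \<le> i}"
    unfolding on_items_frontier[OF frontier] using gam_exp_less_iff[OF _ I(1)] gam_exp_less_tau_exp[OF I(1)]
    by (auto simp: image_iff) (metis le_neq_implies_less less_irrefl, meson less_asym)
  finally have "card {b \<in> improving M (config ph). b < action_code (item ph i)} = card (action_code ` item ph ` {j. j < i \<and> cover j \<le> i})"
    by simp
  also have "\<dots> = card (item ph ` {j. j < i \<and> cover j \<le> i})"
    by (intro card_image inj_on_subset[OF inj]) (use item in auto)
  also have "\<dots> = card {j. j < i \<and> cover j \<le> i}"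
    by (intro card_image inj_on_subset[OF inj_item]) auto
  finally show "card {b \<in> improving M (config ph). b < action_code (item ph i)} = pick \<Pi> (card (improving M (config ph)))"
    using c card_cover_le[OF I(1)] by simp
qed

section \<open>Length of the run\<close>

text \<open>The potential is the number of switches left: a level in phase 3 or 2 will still restart all higher levels.\<close>

definition wt :: "nat \<Rightarrow> nat \<Rightarrow> nat" where
  "wt i p = (if p = 3 then 3 * 2 ^ (n - 1 - i) else if p = 2 then 3 * 2 ^ (n - 1 - i) - 1 else p)"

definition pot :: "(nat \<Rightarrow> nat) \<Rightarrow> nat" where "pot ph = (\<Sum>i<n. wt i (ph i))"

lemma sum_wt_3: "m \<le> n \<Longrightarrow> (\<Sum>j=n - m..<n. wt j 3) = 3 * (2 ^ m - 1)"
proof (induction m)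
  case (Suc m)
  then have *: "{n - Suc m..<n} = insert (n - Suc m) {n - m..<n}" by auto
  have "n - 1 - (n - Suc m) = m" using Suc.prems by simp
  then show ?case using Suc unfolding * by (simp add: wt_def)
qed simp

lemma pot_split:
  assumes "i < n"
  shows "pot ph = (\<Sum>j<i. wt j (ph j)) + wt i (ph i) + (\<Sum>j=Suc i..<n. wt j (ph j))"
proof -
  have "{..<n} = {..<i} \<union> insert i {Suc i..<n}" using assms by auto
  then have "pot ph = (\<Sum>j\<in>{..<i} \<union> insert i {Suc i..<n}. wt j (ph j))" by (simp add: pot_def)
  also have "\<dots> = (\<Sum>j<i. wt j (ph j)) + (\<Sum>j\<in>insert i {Suc i..<n}. wt j (ph j))"
    by (rule sum.union_disjoint) auto
  finally show ?thesis by simp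
qed

text \<open>With \<open>m = n - 1 - i\<close>, a move lowers the weight of level \<open>i\<close>
  from \<open>3 * 2 ^ m - 1\<close> to 1 and restarts the higher levels at total weight
  \<open>3 * 2 ^ m - 3\<close>, a net loss of one.\<close>

lemma pot_step:
  assumes frontier: "frontier i ph" shows "Suc (pot (step i ph)) = pot ph"
proof -
  note I = frontierD[OF frontier]
  let ?w = "\<lambda>ph. \<Sum>j=Suc i..<n. wt j (ph j)"
  have up: "(\<Sum>j<i. wt j (step i ph j)) = (\<Sum>j<i. wt j (ph j))"
    by (intro sum.cong) (auto simp: step_def)
  have zero: "?w ph = 0" using frontier by (auto simp: frontier_def wt_def)
  have i: "ph i = 1 \<or> ph i = 2 \<or> ph i = 3" using phase_cases[OF I(2)[of i]] I(3) by simp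
  show ?thesis
  proof (cases "ph i = 2")
    case True
    have "?w (step i ph) = (\<Sum>j=Suc i..<n. wt j 3)"
      by (intro sum.cong) (use frontier True in \<open>auto simp: step_def frontier_def\<close>)
    also have "\<dots> = 3 * (2 ^ (n - 1 - i) - 1)"
      using sum_wt_3[of "n - 1 - i"] I(1) by simp
    finally have w: "?w (step i ph) = 3 * 2 ^ (n - 1 - i) - 3" by (simp add: diff_mult_distrib2)
    have wi: "wt i (step i ph i) = 1" "wt i (ph i) = 3 * 2 ^ (n - 1 - i) - 1"
      using True by (simp_all add: step_def wt_def)
    have "(1::nat) \<le> 2 ^ (n - 1 - i)" by simp
    then show ?thesis
      unfolding pot_split[OF I(1), of ph] pot_split[OF I(1), of "step i ph"] up zero w wi by linarith
  next
    case False
    have "?w (step i ph) = ?w ph" using False by (intro sum.cong) (auto simp: step_def)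
    moreover have "step i ph i = ph i - 1" by (simp add: step_def)
    moreover have "(1::nat) \<le> 2 ^ (n - 1 - i)" by simp
    ultimately show ?thesis unfolding pot_split[OF I(1), of ph] pot_split[OF I(1), of "step i ph"] up
      using False i by (auto simp: wt_def)
  qed
qed

text \<open>Opening keeps the working level, a move passes work to the top level
  \<open>n - 1\<close>, and closing passes it to the level below; closing at level 0 ends the
  run.\<close>

lemma frontier_step:
  assumes frontier: "frontier i ph" and pos: "0 < pot (step i ph)"
  shows "\<exists>i'. frontier i' (step i ph)"
proof -
  note I = frontierD[OF frontier]
  have i: "ph i = 1 \<or> ph i = 2 \<or> ph i = 3" using phase_cases[OF I(2)[of i]] I(3) by simp
  have le: "step i ph j \<le> 3" for j using I(2)[of j] I(2)[of i] by (auto simp: step_def)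
  consider "ph i = 3" | "ph i = 2" | "ph i = 1" "i = 0" | i' where "ph i = 1" "i = Suc i'"
    using i by (cases i) auto
  then show ?thesis
  proof cases
    case 1
    then have "frontier i (step i ph)" using frontier le by (auto simp: frontier_def step_def)
    then show ?thesis ..
  next
    case 2
    have "step i ph j = (if j < i then ph j else if j = i then 1 else 3)" if "j < n" for j
      using that 2 frontier by (auto simp: step_def frontier_def)
    then have "frontier (n - 1) (step i ph)" using frontier le I(1) by (auto simp: frontier_def)
    then show ?thesis ..
  next
    case 3
    then have "pot (step i ph) = 0" using frontier by (auto simp: pot_def step_def wt_def frontier_def)
    then show ?thesis using pos by simp
  next
    case 4
    then have "frontier i' (step i ph)" using frontier le by (auto simp: frontier_def step_def)
    then show ?thesis ..
  qed
qed

lemma run: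
  assumes \<Pi>: "pivot_rule \<Pi>" "ranking_based \<Pi>" "\<And>k. g k = pick \<Pi> (Suc k)"
    and ph: "frontier i ph" and j: "j \<le> pot ph"
  shows "\<exists>ph'. pi_iter M \<Pi> (config ph) j = config ph' \<and> pot ph' + j = pot ph \<and> (0 < pot ph' \<longrightarrow> (\<exists>i'. frontier i' ph'))"
  using j
proof (induction j)
  case 0
  then show ?case using ph by auto
next
  case (Suc j)
  then obtain ph' where ph': "pi_iter M \<Pi> (config ph) j = config ph'" "pot ph' + j = pot ph"
      "0 < pot ph' \<longrightarrow> (\<exists>i'. frontier i' ph')" by auto
  moreover have "0 < pot ph'" using ph'(2) Suc.prems by simp
  ultimately obtain i' where *: "pi_iter M \<Pi> (config ph) j = config ph'" "pot ph' + j = pot ph" "frontier i' ph'"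
    by blast
  note I = frontierD[OF *(3)]
  have "improving M (config ph') \<noteq> {}" using pivot_dom_config[OF *(3)] by (simp add: pivot_dom_def)
  then have "pi_iter M \<Pi> (config ph) (Suc j) = switch M (config ph') (action_code (item ph' i'))"
    using * picks_item[OF \<Pi> *(3)] by (simp add: Let_def)
  also have "\<dots> = config (step i' ph')"
    unfolding config_def switch_M[OF owner_SS[OF I(1)] item_av] strategy_switch[where ph = ph', OF I(2,3)] ..
  finally have "pi_iter M \<Pi> (config ph) (Suc j) = config (step i' ph')" .
  moreover have "pot (step i' ph') + Suc j = pot ph" using pot_step[OF *(3)] *(2) by simp
  ultimately show ?case using frontier_step[OF *(3)] by (intro exI[of _ "step i' ph'"] conjI impI)
qed

lemma frontier_init: "0 < n \<Longrightarrow> frontier (n - 1) (\<lambda>_. 3)"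
  by (auto simp: frontier_def)

lemma pot_init: "pot (\<lambda>_. 3) = 3 * (2 ^ n - 1)"
  using sum_wt_3[of n] by (simp add: pot_def atLeast0LessThan)

lemma long_run:
  assumes "pivot_rule \<Pi>" "ranking_based \<Pi>" "\<And>k. g k = pick \<Pi> (Suc k)"
    and "0 < n" "j < 2 ^ n"
  shows "improving M (pi_iter M \<Pi> (config (\<lambda>_. 3)) j) \<noteq> {}"
proof -
  \<comment> \<open>\<open>2 ^ n \<ge> 2\<close> ensures
    \<open>2 ^ n \<le> 3 * (2 ^ n - 1)\<close>.\<close>
  have "(2::nat) ^ 1 \<le> 2 ^ n" using assms(4) by (intro power_increasing) auto
  then have j: "j < pot (\<lambda>_. 3)" using assms(5) pot_init by simp
  then obtain ph' i' where "pi_iter M \<Pi> (config (\<lambda>_. 3)) j = config ph'" "frontier i' ph'"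
    using run[OF assms(1-3) frontier_init[OF assms(4)], of j] by fastforce
  then show ?thesis using pivot_dom_config by (simp add: pivot_dom_def)
qed

lemma num_trans_upper: "num_trans M \<le> 12 * (6 * n + 1)"
proof -
  \<comment> \<open>A sensor attains the bound: each of its two actions lists 6 successors.\<close>
  have len: "(\<Sum>a\<in>av s. length (dl a)) \<le> 12" for s
  proof (cases s)
    case (Pt i k)
    then show ?thesis by (cases i) auto
  qed auto
  have "num_trans M \<le> (\<Sum>a\<in>A. length (dl a))" by (rule num_trans_le)
  also have "\<dots> = (\<Sum>s\<in>SS. \<Sum>a\<in>av s. length (dl a))"
    unfolding A_def using av_disj finA finS by (intro sum.UNION_disjoint) auto
  also have "\<dots> \<le> card SS * 12" using sum_bounded_above[of SS, OF len] by simp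
  also have "\<dots> \<le> (6 * n + 1) * 12" using card_SS by (intro mult_right_mono) auto
  finally show ?thesis by simp
qed

lemma num_trans_lower: "n \<le> num_trans M"
proof -
  have "S0 ` {..<n} \<subseteq> A" using AI[of "Sn _" "S0 _"] by auto
  then have "card (S0 ` {..<n}) \<le> card A" using finite_A by (rule card_mono[rotated])
  then show ?thesis using card_A_le by (simp add: card_image inj_on_def)
qed

lemma weak_unichain_config: "weak_unichain_policy M (config ph)"
  unfolding config_def by (intro proper_weak_unichain is_mdp_M proper_pol good_pol_strategy)

end

theorem theorem25:
  fixes \<Pi> :: "mdp \<Rightarrow> (nat \<Rightarrow> nat) \<Rightarrow> nat"
  assumes "pivot_rule \<Pi>" and "ranking_based \<Pi>"
  shows "\<exists>Ms :: nat \<Rightarrow> mdp. \<exists>\<sigma>s :: nat \<Rightarrow> nat \<Rightarrow> nat.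
           (\<forall>n. weak_unichain_mdp (Ms n) \<and> weak_unichain_policy (Ms n) (\<sigma>s n)) \<and>
           filterlim (\<lambda>n. num_trans (Ms n)) at_top sequentially \<and>
           (\<exists>c > 0. \<forall>\<^sub>F n in sequentially. \<forall>j :: nat.
              real j < c * 2 powr sqrt (real (num_trans (Ms n))) \<longrightarrow>
              improving (Ms n) (pi_iter (Ms n) \<Pi> (\<sigma>s n) j) \<noteq> {})"
proof -
  define g where "g k = pick \<Pi> (Suc k)" for k
  have "g k \<le> k" for k using pick_less[OF assms(1), of "Suc k"] by (simp add: g_def)
  then interpret st: counter n g for n by unfold_locales
  define Ms where "Ms n = st.M n" for n
  define \<sigma>s where "\<sigma>s n = st.config n (\<lambda>_. 3)" for n
  have "weak_unichain_mdp (Ms n) \<and> weak_unichain_policy (Ms n) (\<sigma>s n)" for n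
    unfolding Ms_def \<sigma>s_def using st.weak_unichain_M st.weak_unichain_config by blast
  moreover have "filterlim (\<lambda>n. num_trans (Ms n)) at_top sequentially"
    unfolding Ms_def using st.num_trans_lower
    by (intro filterlim_at_top_mono[OF filterlim_ident]) auto
  moreover have "\<forall>\<^sub>F n in sequentially. \<forall>j :: nat.
      real j < 1 * 2 powr sqrt (real (num_trans (Ms n))) \<longrightarrow>
      improving (Ms n) (pi_iter (Ms n) \<Pi> (\<sigma>s n) j) \<noteq> {}"
    \<comment> \<open>From 73 on, \<open>72 * n + 12 \<le> 73 * n \<le> n ^ 2\<close>, so the square
      root of the linear transition count is at most \<open>n\<close>.\<close>
    using eventually_ge_at_top[of 73]
  proof eventually_elim
    case (elim n)
    have "num_trans (Ms n) \<le> 72 * n + 12" using st.num_trans_upper[of n] by (simp add: Ms_def)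
    also have "\<dots> \<le> 73 * n" using elim by simp
    also have "\<dots> \<le> n ^ 2" using elim by (simp add: power2_eq_square)
    finally have "sqrt (real (num_trans (Ms n))) \<le> real n"
      by (intro real_le_lsqrt) (auto simp flip: of_nat_power)
    then have "2 powr sqrt (real (num_trans (Ms n))) \<le> 2 powr real n" by simp
    also have "\<dots> = real (2 ^ n)" by (simp add: powr_realpow)
    finally have le: "2 powr sqrt (real (num_trans (Ms n))) \<le> real (2 ^ n)" .
    have "0 < n" using elim by simp
    show ?case
    proof (intro allI impI)
      fix j assume "real j < 1 * 2 powr sqrt (real (num_trans (Ms n)))"
      then have "j < 2 ^ n" using le by (metis mult_1 of_nat_less_iff order_less_le_trans)
      then show "improving (Ms n) (pi_iter (Ms n) \<Pi> (\<sigma>s n) j) \<noteq> {}"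
        unfolding Ms_def \<sigma>s_def using st.long_run[OF assms g_def \<open>0 < n\<close>] by blast
    qed
  qed
  ultimately show ?thesis by (intro exI[of _ Ms] exI[of _ \<sigma>s] conjI allI exI[of _ "1::real"]) auto
qed

end
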